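(* Let $\mathcal{T}'\in\mathbb{K}^{I_1\times I_2\times I_3}$ have multilinear rank $(R,R,K)$, and let $\mathcal{T}\in\mathbb{K}^{R\times R\times K}$ be an orthogonal compression of $\mathcal{T}'$. Then: (1) $\mathcal{T}'$ has $\mathbb{K}$-rank $R$ if and only if the JGE vectors of $\mathcal{T}$ span $\mathbb{K}^R$. Furthermore, if $\mathcal{T}=[\![\mathbf{A},\mathbf{B},\mathbf{C}]\!]$ has $\mathbb{K}$-rank $R$, then the JGE values of $\mathcal{T}$ are exactly the spans of the columns of $\mathbf{C}$, and the columns of $\mathbf{B}^{-\mathrm{T}}$ are JGE vectors of $\mathcal{T}$. (2) If $\mathcal{T}'$ has border $\mathbb{K}$-rank $R$ and $\mathcal{T}$ is simple, then $\mathcal{T}'$ has $\mathbb{K}$-rank $R$. (3) If $\mathcal{T}'$ has border $\mathbb{K}$-rank $R$ but $\mathbb{K}$-rank strictly greater than $R$, and $\mathcal{T}$ is slice mix invertible, then $\mathcal{T}$ has a JGE value $\mathscr{L}\subset\mathbb{K}^K$ with $\mathrm{am}(\mathscr{L})>\mathrm{gm}(\mathscr{L})\geq 1$.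
   Context: $\mathbb{K}$ denotes $\mathbb{R}$ or $\mathbb{C}$. A rank one tensor is $\mathbf{a}\otimes\mathbf{b}\otimes\mathbf{c}$ with nonzero vectors, $(\mathbf{a}\otimes\mathbf{b}\otimes\mathbf{c})_{ijk}=a_ib_jc_k$. The $\mathbb{K}$-rank of a tensor is the least number of rank one tensors with $\mathbb{K}$-valued factors summing to it; a minimal such sum $\sum_{r=1}^R\mathbf{a}_r\otimes\mathbf{b}_r\otimes\mathbf{c}_r$ is a CPD, written $[\![\mathbf{A},\mathbf{B},\mathbf{C}]\!]$ where $\mathbf{A},\mathbf{B},\mathbf{C}$ have columns $\mathbf{a}_r,\mathbf{b}_r,\mathbf{c}_r$. The border $\mathbb{K}$-rank is the least $R$ such that the tensor is a limit of tensors of $\mathbb{K}$-rank at most $R$. For $\mathcal{M}'\in\mathbb{K}^{I_1\times I_2\times I_3}$, $R_1(\mathcal{M}')=\dim\mathrm{span}\{\mathcal{M}'(:,k,\ell)\}$, $R_2(\mathcal{M}')=\dim\mathrm{span}\{\mathcal{M}'(j,:,\ell)\}$, $R_3(\mathcal{M}')=\dim\mathrm{span}\{\mathcal{M}'(j,k,:)\}$ (spans of mode-$1,2,3$ fibers); $(R_1,R_2,R_3)$ is the multilinear rank. The mode-$i$ product $\mathcal{M}'\cdot_i\mathbf{U}$ applies the matrix $\mathbf{U}$ to every mode-$i$ fiber. An orthogonal compression of $\mathcal{T}'$ with multilinear rank $(R,R,K)$ is $\mathcal{T}'\cdot_1\mathbf{V}_1^{\mathrm{H}}\cdot_2\mathbf{V}_2^{\mathrm{H}}\cdot_3\mathbf{V}_3^{\mathrm{H}}$,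 where $\mathbf{V}_i$ has orthonormal columns forming a basis of the span of the mode-$i$ fibers of $\mathcal{T}'$. For $\mathcal{T}\in\mathbb{K}^{R\times R\times K}$ let $\mathbf{T}_k=\mathcal{T}(:,:,k)$. $\mathcal{T}$ is slice mix invertible if some linear combination of $\mathbf{T}_1,\dots,\mathbf{T}_K$ is invertible. A nonzero $\mathbf{x}\in\mathbb{K}^R$ is a joint generalized eigenvector (JGE vector) of $\mathcal{T}$ if there are $\boldsymbol{\lambda}\in\mathbb{K}^K$ and nonzero $\mathbf{y}\in\mathbb{K}^R$ with $\mathbf{T}_\ell\mathbf{x}=\lambda_\ell\mathbf{y}$ for all $\ell=1,\dots,K$; then $\mathrm{span}(\boldsymbol{\lambda})$ is a JGE value and $(\mathrm{span}(\boldsymbol{\lambda}),\mathbf{x})$ a JGE pair. The characteristic polynomial is $p_{\mathcal{T}}(\boldsymbol{\gamma})=\det(\sum_{k=1}^K\gamma_k\mathbf{T}_k)$. For nonzero $\boldsymbol{\lambda}$, $\mathrm{am}(\mathrm{span}(\boldsymbol{\lambda}))$ is the largest $m$ such that $(\lambda_1\gamma_1+\cdots+\lambda_K\gamma_K)^m$ divides $p_{\mathcal{T}}$, and $\mathrm{gm}(\mathrm{span}(\boldsymbol{\lambda}))$ is the dimension of the span of the JGE vectors $\mathbf{x}$ for which $(\mathrm{span}(\boldsymbol{\lambda}),\mathbf{x})$ is a JGE pair. $\mathcal{T}$ is simple if it is slice mix invertible and $p_{\mathcal{T}}$ factors as a product of $R$ pairwise non-proportional linear forms (i.e. $R$ distinct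 JGE values each of algebraic multiplicity $1$). *)

theory Defs
  imports "Jordan_Normal_Form.VS_Connect" "Jordan_Normal_Form.Jordan_Normal_Form" "Jordan_Normal_Form.Conjugate"
    "HOL.Real_Vector_Spaces"
begin

text \<open>A tensor in K^(I1 x I2 x I3) is a function of three (0-based) indices that
  vanishes outside the index box.\<close>

type_synonym 'a tensor3 = "nat \<Rightarrow> nat \<Rightarrow> nat \<Rightarrow> 'a"

definition tensor3_in :: "nat \<Rightarrow> nat \<Rightarrow> nat \<Rightarrow> 'a::zero tensor3 \<Rightarrow> bool" where
  "tensor3_in I1 I2 I3 T \<longleftrightarrow>
     (\<forall>i j k. \<not> (i < I1 \<and> j < I2 \<and> k < I3) \<longrightarrow> T i j k = 0)"

definition cpd :: "nat \<Rightarrow> nat \<Rightarrow> nat \<Rightarrow> nat \<Rightarrow> 'a::comm_ring_1 mat \<Rightarrow> 'a mat \<Rightarrow> 'a mat \<Rightarrow> 'a tensor3" where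
  "cpd I1 I2 I3 R A B C = (\<lambda>i j k. if i < I1 \<and> j < I2 \<and> k < I3
      then (\<Sum>r<R. A $$ (i, r) * B $$ (j, r) * C $$ (k, r)) else 0)"

definition is_decomp :: "nat \<Rightarrow> nat \<Rightarrow> nat \<Rightarrow> 'a::comm_ring_1 tensor3 \<Rightarrow> nat
     \<Rightarrow> 'a mat \<Rightarrow> 'a mat \<Rightarrow> 'a mat \<Rightarrow> bool" where
  "is_decomp I1 I2 I3 T R A B C \<longleftrightarrow>
     A \<in> carrier_mat I1 R \<and> B \<in> carrier_mat I2 R \<and> C \<in> carrier_mat I3 R \<and>
     (\<forall>r<R. col A r \<noteq> 0\<^sub>v I1 \<and> col B r \<noteq> 0\<^sub>v I2 \<and> col C r \<noteq> 0\<^sub>v I3) \<and>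
     T = cpd I1 I2 I3 R A B C"

definition tensor_rank :: "nat \<Rightarrow> nat \<Rightarrow> nat \<Rightarrow> 'a::comm_ring_1 tensor3 \<Rightarrow> nat" where
  "tensor_rank I1 I2 I3 T = (LEAST R. \<exists>A B C. is_decomp I1 I2 I3 T R A B C)"

text \<open>Border K-rank: least R such that T is a limit of tensors of K-rank at most R
  (entrywise convergence, equivalently in any norm on the finite-dimensional space).\<close>

definition border_rank :: "nat \<Rightarrow> nat \<Rightarrow> nat \<Rightarrow> 'a::{comm_ring_1, real_normed_vector} tensor3 \<Rightarrow> nat" where
  "border_rank I1 I2 I3 T = (LEAST R. \<exists>S :: nat \<Rightarrow> 'a tensor3.
      (\<forall>n. tensor3_in I1 I2 I3 (S n) \<and> tensor_rank I1 I2 I3 (S n) \<le> R) \<and>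
      (\<forall>i j k. (\<lambda>n. S n i j k) \<longlonglongrightarrow> T i j k))"

definition vspan :: "nat \<Rightarrow> 'a::field vec set \<Rightarrow> 'a vec set" where
  "vspan n S = LinearCombinations.module.span class_ring (module_vec TYPE('a) n) S"

definition vdim :: "nat \<Rightarrow> 'a::field vec set \<Rightarrow> nat" where
  "vdim n S = vectorspace.dim class_ring ((module_vec TYPE('a) n)\<lparr>carrier := vspan n S\<rparr>)"

definition fibers1 :: "nat \<Rightarrow> nat \<Rightarrow> nat \<Rightarrow> 'a tensor3 \<Rightarrow> 'a vec set" where
  "fibers1 I1 I2 I3 T = {vec I1 (\<lambda>i. T i j k) | j k. j < I2 \<and> k < I3}"

definition fibers2 :: "nat \<Rightarrow> nat \<Rightarrow> nat \<Rightarrow> 'a tensor3 \<Rightarrow> 'a vec set" where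
  "fibers2 I1 I2 I3 T = {vec I2 (\<lambda>j. T i j k) | i k. i < I1 \<and> k < I3}"

definition fibers3 :: "nat \<Rightarrow> nat \<Rightarrow> nat \<Rightarrow> 'a tensor3 \<Rightarrow> 'a vec set" where
  "fibers3 I1 I2 I3 T = {vec I3 (\<lambda>k. T i j k) | i j. i < I1 \<and> j < I2}"

definition mlrank :: "nat \<Rightarrow> nat \<Rightarrow> nat \<Rightarrow> 'a::field tensor3 \<Rightarrow> nat \<times> nat \<times> nat" where
  "mlrank I1 I2 I3 T = (vdim I1 (fibers1 I1 I2 I3 T), vdim I2 (fibers2 I1 I2 I3 T),
                        vdim I3 (fibers3 I1 I2 I3 T))"

definition adj :: "'a::conjugatable_field mat \<Rightarrow> 'a mat" where
  "adj V = mat (dim_col V) (dim_row V) (\<lambda>(a, i). conjugate (V $$ (i, a)))"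

definition orth_basis_mat :: "nat \<Rightarrow> nat \<Rightarrow> 'a::conjugatable_field vec set \<Rightarrow> 'a mat \<Rightarrow> bool" where
  "orth_basis_mat n r S V \<longleftrightarrow> V \<in> carrier_mat n r \<and> adj V * V = 1\<^sub>m r \<and>
     vspan n (set (cols V)) = vspan n S"

definition compress :: "nat \<Rightarrow> nat \<Rightarrow> nat \<Rightarrow> nat \<Rightarrow> nat \<Rightarrow> nat \<Rightarrow> 'a::conjugatable_field tensor3
     \<Rightarrow> 'a mat \<Rightarrow> 'a mat \<Rightarrow> 'a mat \<Rightarrow> 'a tensor3" where
  "compress I1 I2 I3 R1 R2 R3 T V1 V2 V3 = (\<lambda>a b c. if a < R1 \<and> b < R2 \<and> c < R3 then
      (\<Sum>i<I1. \<Sum>j<I2. \<Sum>k<I3. conjugate (V1 $$ (i, a)) * conjugate (V2 $$ (j, b)) *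
          conjugate (V3 $$ (k, c)) * T i j k) else 0)"

definition orth_compression :: "nat \<Rightarrow> nat \<Rightarrow> nat \<Rightarrow> nat \<Rightarrow> nat \<Rightarrow> nat
     \<Rightarrow> 'a::conjugatable_field tensor3 \<Rightarrow> 'a tensor3 \<Rightarrow> bool" where
  "orth_compression I1 I2 I3 R1 R2 R3 T' T \<longleftrightarrow> (\<exists>V1 V2 V3.
      orth_basis_mat I1 R1 (fibers1 I1 I2 I3 T') V1 \<and>
      orth_basis_mat I2 R2 (fibers2 I1 I2 I3 T') V2 \<and>
      orth_basis_mat I3 R3 (fibers3 I1 I2 I3 T') V3 \<and>
      T = compress I1 I2 I3 R1 R2 R3 T' V1 V2 V3)"

definition slice :: "nat \<Rightarrow> 'a tensor3 \<Rightarrow> nat \<Rightarrow> 'a mat" where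
  "slice R T k = mat R R (\<lambda>(i, j). T i j k)"

definition slice_comb :: "nat \<Rightarrow> nat \<Rightarrow> 'a::comm_ring_1 tensor3 \<Rightarrow> 'a vec \<Rightarrow> 'a mat" where
  "slice_comb R K T \<gamma> = mat R R (\<lambda>(i, j). \<Sum>k<K. \<gamma> $ k * T i j k)"

definition slice_mix_invertible :: "nat \<Rightarrow> nat \<Rightarrow> 'a::comm_ring_1 tensor3 \<Rightarrow> bool" where
  "slice_mix_invertible R K T \<longleftrightarrow> (\<exists>\<gamma> \<in> carrier_vec K. invertible_mat (slice_comb R K T \<gamma>))"

definition jge_pair :: "nat \<Rightarrow> nat \<Rightarrow> 'a::field tensor3 \<Rightarrow> 'a vec set \<Rightarrow> 'a vec \<Rightarrow> bool" where
  "jge_pair R K T L x \<longleftrightarrow> x \<in> carrier_vec R \<and> x \<noteq> 0\<^sub>v R \<and>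
     (\<exists>lam y. lam \<in> carrier_vec K \<and> y \<in> carrier_vec R \<and> y \<noteq> 0\<^sub>v R \<and>
        (\<forall>l<K. slice R T l *\<^sub>v x = lam $ l \<cdot>\<^sub>v y) \<and> L = vspan K {lam})"

definition jge_vector :: "nat \<Rightarrow> nat \<Rightarrow> 'a::field tensor3 \<Rightarrow> 'a vec \<Rightarrow> bool" where
  "jge_vector R K T x \<longleftrightarrow> (\<exists>L. jge_pair R K T L x)"

definition jge_value :: "nat \<Rightarrow> nat \<Rightarrow> 'a::field tensor3 \<Rightarrow> 'a vec set \<Rightarrow> bool" where
  "jge_value R K T L \<longleftrightarrow> (\<exists>x. jge_pair R K T L x)"

definition char_poly_fun :: "nat \<Rightarrow> nat \<Rightarrow> 'a::comm_ring_1 tensor3 \<Rightarrow> 'a vec \<Rightarrow> 'a" where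
  "char_poly_fun R K T \<gamma> = det (slice_comb R K T \<gamma>)"

text \<open>Polynomial functions in K variables (K is infinite, so polynomial functions and
  polynomials in K[gamma_1,...,gamma_K] correspond bijectively).\<close>

definition mpoly_fun :: "nat \<Rightarrow> ('a::comm_ring_1 vec \<Rightarrow> 'a) \<Rightarrow> bool" where
  "mpoly_fun K f \<longleftrightarrow> (\<exists>(S :: (nat \<Rightarrow> nat) set) c. finite S \<and>
     (\<forall>\<gamma> \<in> carrier_vec K. f \<gamma> = (\<Sum>\<alpha>\<in>S. c \<alpha> * (\<Prod>k<K. (\<gamma> $ k) ^ \<alpha> k))))"

definition lin_form :: "nat \<Rightarrow> 'a::comm_ring_1 vec \<Rightarrow> 'a vec \<Rightarrow> 'a" where
  "lin_form K lam \<gamma> = (\<Sum>k<K. lam $ k * \<gamma> $ k)"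

definition lin_pow_dvd_char :: "nat \<Rightarrow> nat \<Rightarrow> 'a::comm_ring_1 tensor3 \<Rightarrow> 'a vec \<Rightarrow> nat \<Rightarrow> bool" where
  "lin_pow_dvd_char R K T lam m \<longleftrightarrow> (\<exists>q. mpoly_fun K q \<and>
     (\<forall>\<gamma> \<in> carrier_vec K. char_poly_fun R K T \<gamma> = lin_form K lam \<gamma> ^ m * q \<gamma>))"

definition jge_am :: "nat \<Rightarrow> nat \<Rightarrow> 'a::field tensor3 \<Rightarrow> 'a vec set \<Rightarrow> nat" where
  "jge_am R K T L = (GREATEST m. \<exists>lam. lam \<in> carrier_vec K \<and> lam \<noteq> 0\<^sub>v K \<and>
      L = vspan K {lam} \<and> lin_pow_dvd_char R K T lam m)"

definition jge_gm :: "nat \<Rightarrow> nat \<Rightarrow> 'a::field tensor3 \<Rightarrow> 'a vec set \<Rightarrow> nat" where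
  "jge_gm R K T L = vdim R {x. jge_pair R K T L x}"

definition simple_tensor :: "nat \<Rightarrow> nat \<Rightarrow> 'a::field tensor3 \<Rightarrow> bool" where
  "simple_tensor R K T \<longleftrightarrow> slice_mix_invertible R K T \<and>
     (\<exists>l :: nat \<Rightarrow> 'a vec. (\<forall>r<R. l r \<in> carrier_vec K) \<and>
        (\<forall>r<R. \<forall>s<R. r \<noteq> s \<longrightarrow> \<not> (\<exists>c. l r = c \<cdot>\<^sub>v l s)) \<and>
        (\<forall>\<gamma> \<in> carrier_vec K. char_poly_fun R K T \<gamma> = (\<Prod>r<R. lin_form K (l r) \<gamma>)))"

end

theory Submission
  imports Defs "Jordan_Normal_Form.DL_Rank" "HOL-Analysis.Elementary_Metric_Spaces"
begin

text \<open>
  Write \<open>T = [A, B, C]\<close> with \<open>R\<close> terms. As the mode-1 and mode-2 fibers of \<open>T'\<close> span spaces of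
  dimension \<open>R\<close>, \<open>A\<close> and \<open>B\<close> are invertible, and the slices \<open>A diag(C(k, :)) B\<^sup>T\<close> map the columns of
  \<open>B\<^sup>-\<^sup>T\<close> to multiples of the columns of \<open>A\<close>; conversely a basis of JGE vectors diagonalises all
  slices at once.

  If \<open>T\<close> is a limit of such tensors and a mix \<open>N\<close> of its slices is invertible, the JGE pairs are
  the joint eigenpairs of the \<open>N\<^sup>-\<^sup>1T\<^sub>k\<close>. Those of the approximants, normalised to length one,
  subconverge to \<open>R\<close> JGE pairs of \<open>T\<close> (the scalar field is locally compact), and the characteristic
  polynomial of \<open>T\<close> is a multiple of the product of the \<open>R\<close> limiting linear forms. Hence \<open>am(L)\<close> is
  at least the number of limiting values equal to \<open>L\<close>. Eigenvectors of distinct values are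
  independent, so if \<open>gm(L) \<ge> am(L)\<close> for all of these values, there are \<open>R\<close> independent JGE vectors
  and \<open>T\<close> has rank \<open>R\<close>. For a simple tensor \<open>am \<ge> 2\<close> is impossible.
\<close>

section \<open>Linear algebra\<close>

lemma vspan_superset:
  fixes S :: "'a::field vec set"
  assumes "S \<subseteq> carrier_vec n"
  shows "S \<subseteq> vspan n S"
proof -
  interpret vec_space "TYPE('a)" n .
  show ?thesis unfolding vspan_def using in_own_span assms by auto
qed

lemma vspan_subset_carrier:
  fixes S :: "'a::field vec set"
  assumes "S \<subseteq> carrier_vec n"
  shows "vspan n S \<subseteq> carrier_vec n"
proof -
  interpret vec_space "TYPE('a)" n .
  show ?thesis unfolding vspan_def using span_closed assms by auto
qed

lemma vspan_mono:
  fixes S :: "'a::field vec set"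
  assumes "S \<subseteq> S'"
  shows "vspan n S \<subseteq> vspan n S'"
proof -
  interpret vec_space "TYPE('a)" n .
  show ?thesis unfolding vspan_def using assms by (rule span_is_monotone)
qed

lemma vspan_minimal:
  fixes S U :: "'a::field vec set"
  assumes "U \<subseteq> carrier_vec n" "S \<subseteq> vspan n U"
  shows "vspan n S \<subseteq> vspan n U"
proof -
  interpret vec_space "TYPE('a)" n .
  show ?thesis
    using assms span_is_subset span_is_submodule unfolding vspan_def by metis
qed

lemma vspan_cols_iff:
  fixes A :: "'a::field mat"
  assumes A: "A \<in> carrier_mat n m"
  shows "v \<in> vspan n (set (cols A)) \<longleftrightarrow> (\<exists>x\<in>carrier_vec m. v = A *\<^sub>v x)"
proof -
  interpret vec_space "TYPE('a)" n .
  show ?thesis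
    using col_space_eq[OF A] A unfolding vspan_def col_space_def by auto
qed

lemma set_cols_subset_carrier: "A \<in> carrier_mat n m \<Longrightarrow> set (cols A) \<subseteq> carrier_vec n"
  using cols_dim by blast

lemma vspan_singleton:
  fixes v :: "'a::field vec"
  assumes v: "v \<in> carrier_vec n"
  shows "vspan n {v} = range (\<lambda>c. c \<cdot>\<^sub>v v)"
proof -
  let ?A = "mat_of_cols n [v]"
  have "vspan n {v} = {u. \<exists>x\<in>carrier_vec 1. u = ?A *\<^sub>v x}"
    using vspan_cols_iff[of ?A n 1] v by (auto simp: carrier_matI)
  also have "\<dots> = {u. \<exists>x\<in>carrier_vec 1. u = (x $ 0) \<cdot>\<^sub>v v}"
  proof -
    have "?A *\<^sub>v x = (x $ 0) \<cdot>\<^sub>v v" if "x \<in> carrier_vec 1" for x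
      using that v by (intro eq_vecI) (auto simp: scalar_prod_def mat_of_cols_index)
    then show ?thesis by auto
  qed
  also have "\<dots> = range (\<lambda>c. c \<cdot>\<^sub>v v)"
    by (auto intro: bexI[of _ "vec 1 (\<lambda>_. c)" for c])
  finally show ?thesis .
qed

lemma vspan_singleton_eq_iff:
  fixes v w :: "'a::field vec"
  assumes v: "v \<in> carrier_vec n" and w: "w \<in> carrier_vec n" "w \<noteq> 0\<^sub>v n"
  shows "vspan n {w} = vspan n {v} \<longleftrightarrow> (\<exists>c. c \<noteq> 0 \<and> w = c \<cdot>\<^sub>v v)"
proof
  assume "vspan n {w} = vspan n {v}"
  then have "w \<in> vspan n {v}" using vspan_superset[of "{w}" n] w by auto
  then obtain c where "w = c \<cdot>\<^sub>v v" using vspan_singleton[OF v] by auto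
  then show "\<exists>c. c \<noteq> 0 \<and> w = c \<cdot>\<^sub>v v" using w v by (intro exI[of _ c]) auto
next
  assume "\<exists>c. c \<noteq> 0 \<and> w = c \<cdot>\<^sub>v v"
  then obtain c where c: "c \<noteq> 0" "w = c \<cdot>\<^sub>v v" by blast
  have "\<exists>b. a \<cdot>\<^sub>v v = b \<cdot>\<^sub>v w" for a
    using c by (intro exI[of _ "a / c"]) (simp add: smult_smult_assoc)
  moreover have "\<exists>b. a \<cdot>\<^sub>v w = b \<cdot>\<^sub>v v" for a
    using c by (intro exI[of _ "a * c"]) (simp add: smult_smult_assoc)
  ultimately show "vspan n {w} = vspan n {v}"
    unfolding vspan_singleton[OF v] vspan_singleton[OF w(1)]
    by (intro subset_antisym image_subsetI) (simp_all add: image_iff)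
qed

lemma smult_vec_eq_imp_eq_divide:
  fixes u w :: "'a::field vec"
  assumes c: "c \<noteq> 0" and eq: "c \<cdot>\<^sub>v u = d \<cdot>\<^sub>v w"
  shows "u = (d / c) \<cdot>\<^sub>v w"
proof -
  have "u = inverse c \<cdot>\<^sub>v (c \<cdot>\<^sub>v u)" using c by (simp add: smult_smult_assoc)
  then show ?thesis unfolding eq by (simp add: smult_smult_assoc divide_inverse mult.commute)
qed

lemma index_mult_mat_vec_sum:
  assumes "A \<in> carrier_mat n m" "v \<in> carrier_vec m" "i < n"
  shows "(A *\<^sub>v v) $ i = (\<Sum>j<m. A $$ (i, j) * v $ j)"
  using assms by (auto simp: scalar_prod_def lessThan_atLeast0 intro!: sum.cong)

lemma index_mult_mat_sum:
  assumes "A \<in> carrier_mat n m" "B \<in> carrier_mat m p" "i < n" "j < p"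
  shows "(A * B) $$ (i, j) = (\<Sum>k<m. A $$ (i, k) * B $$ (k, j))"
  using assms by (auto simp: scalar_prod_def lessThan_atLeast0 intro!: sum.cong)

lemma mult_unit_vec_eq_col:
  fixes A :: "'a::comm_ring_1 mat"
  assumes "A \<in> carrier_mat n m" "j < m"
  shows "A *\<^sub>v unit_vec m j = col A j"
  using assms by (metis col_mult2 col_one one_carrier_mat right_mult_one_mat)

lemma mult_mat_zero_vec: "A \<in> carrier_mat n m \<Longrightarrow> A *\<^sub>v 0\<^sub>v m = 0\<^sub>v n"
  by (intro eq_vecI) auto

lemma mat_diag_mult_vec:
  fixes v :: "'a::comm_ring_1 vec"
  assumes v: "v \<in> carrier_vec n"
  shows "mat_diag n f *\<^sub>v v = vec n (\<lambda>i. f i * v $ i)"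
proof (rule eq_vecI)
  fix i assume "i < dim_vec (vec n (\<lambda>i. f i * v $ i))"
  then have i: "i < n" by simp
  have "(mat_diag n f *\<^sub>v v) $ i = (\<Sum>j<n. if j = i then f i * v $ i else 0)"
    unfolding index_mult_mat_vec_sum[OF mat_diag_dim v i]
    using i by (intro sum.cong) (auto simp: mat_diag_def)
  then show "(mat_diag n f *\<^sub>v v) $ i = vec n (\<lambda>i. f i * v $ i) $ i" using i by simp
qed (simp add: mat_diag_def)

lemma invertible_mat_iff_det:
  fixes A :: "'a::field mat"
  assumes A: "A \<in> carrier_mat n n"
  shows "invertible_mat A \<longleftrightarrow> det A \<noteq> 0"
proof
  assume "invertible_mat A"
  then obtain B where AB: "A * B = 1\<^sub>m n" and BA: "B * A = 1\<^sub>m (dim_row B)"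
    using A by (auto simp: invertible_mat_def inverts_mat_def)
  have "dim_col B = n" "dim_row B = n"
    using arg_cong[OF AB, of dim_col] arg_cong[OF BA, of dim_col] A by auto
  then have "det A * det B = 1" using det_mult[OF A carrier_matI, of B] AB by simp
  then show "det A \<noteq> 0" by auto
next
  assume "det A \<noteq> 0"
  then show "invertible_mat A"
    using det_non_zero_imp_unit[OF A, of "()"] A
    unfolding Units_def ring_mat_def invertible_mat_def inverts_mat_def by auto
qed

lemma det_nonzero_obtain_inverse:
  fixes A :: "'a::field mat"
  assumes A: "A \<in> carrier_mat n n" and "det A \<noteq> 0"
  obtains B where "B \<in> carrier_mat n n" "A * B = 1\<^sub>m n" "B * A = 1\<^sub>m n"
  using det_non_zero_imp_unit[OF assms, of "()"] unfolding Units_def ring_mat_def by auto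

lemma det_nonzero_obtain_dual:
  fixes B :: "'a::field mat"
  assumes B: "B \<in> carrier_mat n n" "det B \<noteq> 0"
  obtains X where "X \<in> carrier_mat n n" "det X \<noteq> 0" "transpose_mat B * X = 1\<^sub>m n"
proof -
  obtain X where X: "X \<in> carrier_mat n n" "transpose_mat B * X = 1\<^sub>m n"
    using det_nonzero_obtain_inverse[of "transpose_mat B" n] B by (auto simp: det_transpose)
  moreover have "det X \<noteq> 0" using det_mult[of "transpose_mat B" n X] X B(1) by auto
  ultimately show thesis using that by blast
qed

lemma det_nonzero_mult_vec_eq_0_iff:
  fixes A :: "'a::field mat"
  assumes "A \<in> carrier_mat n n" "det A \<noteq> 0" "v \<in> carrier_vec n"
  shows "A *\<^sub>v v = 0\<^sub>v n \<longleftrightarrow> v = 0\<^sub>v n"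
  using assms det_0_iff_vec_prod_zero_field[OF assms(1)] by auto

lemma
  fixes A :: "'a::field mat"
  assumes A: "A \<in> carrier_mat n m" and full: "vspan n (set (cols A)) = carrier_vec n"
  shows cols_span_carrier_imp_le: "n \<le> m" and cols_span_carrier_imp_det: "m = n \<Longrightarrow> det A \<noteq> 0"
proof -
  interpret vec_space "TYPE('a)" n .
  have "rank A = n"
    using full dim_is_n by (simp add: rank_def vspan_def cV[symmetric] del: cV)
  then show "n \<le> m" "m = n \<Longrightarrow> det A \<noteq> 0"
    using rank_le_nc[OF A] det_rank_iff A by auto
qed

definition independent_family :: "nat \<Rightarrow> 'i set \<Rightarrow> ('i \<Rightarrow> 'a::field vec) \<Rightarrow> bool" where
  "independent_family n X z \<longleftrightarrow>
     (\<forall>a. (\<forall>i<n. (\<Sum>r\<in>X. a r * z r $ i) = 0) \<longrightarrow> (\<forall>r\<in>X. a r = 0))"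

lemma independent_family_cong:
  assumes "\<And>r. r \<in> X \<Longrightarrow> z r = z' r"
  shows "independent_family n X z \<longleftrightarrow> independent_family n X z'"
  unfolding independent_family_def using assms by (simp cong: sum.cong)

lemma (in vec_space) obtain_vdim_basis:
  assumes S: "S \<subseteq> carrier_vec n"
  obtains U where "U \<subseteq> S" "finite U" "lin_indpt U" "card U = vdim n S" "span U = span S"
proof -
  have "\<exists>U. finite U \<and> maximal U (\<lambda>A. A \<subseteq> S \<and> lin_indpt A)"
  proof (rule maximal_exists[of _ n "{}"])
    show "\<And>A. A \<subseteq> S \<and> lin_indpt A \<Longrightarrow> finite A \<and> card A \<le> n"
      using S li_le_dim dim_is_n fin_dim by (metis subset_trans)
  qed (simp add: lin_dep_def)
  then obtain U where finite_U: "finite U" and U: "maximal U (\<lambda>A. A \<subseteq> S \<and> lin_indpt A)" by blast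
  have U_subset: "U \<subseteq> S" and indpt: "lin_indpt U" using U unfolding maximal_def by auto
  then have U_carrier: "U \<subseteq> carrier_vec n" using S by auto
  have "s \<in> span U" if s: "s \<in> S" for s
  proof (rule ccontr)
    assume notin_span: "s \<notin> span U"
    then have notin_U: "s \<notin> U" using U_carrier in_own_span by auto
    have "lin_indpt (U \<union> {s})"
      using lin_dep_iff_in_span[of U s] U_carrier indpt notin_U s S notin_span by auto
    then have "U \<union> {s} = U" using U U_subset s unfolding maximal_def by auto
    then show False using notin_U by auto
  qed
  then have span_eq: "span U = span S"
    using span_is_monotone[OF U_subset] span_is_subset[of S "span U"] span_is_submodule U_carrier
    by auto
  have "maximal U (\<lambda>A. A \<subseteq> U \<and> lin_indpt A)" using indpt unfolding maximal_def by auto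
  then have "card U = vdim n S"
    using dim_span[OF U_carrier finite_U] unfolding vdim_def vspan_def span_eq[symmetric] by simp
  then show thesis using that U_subset finite_U indpt span_eq by blast
qed

lemma vdim_obtain_independent_family:
  fixes S :: "'a::field vec set"
  assumes S: "S \<subseteq> carrier_vec n" and X: "finite X" "card X \<le> vdim n S"
  obtains z where "\<And>r. r \<in> X \<Longrightarrow> z r \<in> S" "independent_family n X z"
proof -
  interpret vec_space "TYPE('a)" n .
  obtain U where U: "U \<subseteq> S" "finite U" "lin_indpt U" "card U = vdim n S"
    by (rule obtain_vdim_basis[OF S])
  then obtain z where z: "inj_on z X" "z ` X \<subseteq> U"
    using card_le_inj[of X U] X by auto
  have indpt: "lin_indpt (z ` X)" using subset_li_is_li[OF U(3) z(2)] .
  have image_z: "z ` X \<subseteq> carrier_vec n" "finite (z ` X)" using z U(1) S X by auto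
  have "a r = 0" if zero: "\<forall>i<n. (\<Sum>r\<in>X. a r * z r $ i) = 0" and r: "r \<in> X" for a r
  proof (rule ccontr)
    assume "a r \<noteq> 0"
    let ?b = "\<lambda>u. a (the_inv_into X z u)"
    have "lincomb ?b (z ` X) $ i = (\<Sum>r\<in>X. a r * z r $ i)" if "i < n" for i
      using that image_z by (simp add: lincomb_index sum.reindex[OF z(1)] the_inv_into_f_f[OF z(1)])
    then have "lincomb ?b (z ` X) = 0\<^sub>v n"
      using zero image_z by (intro eq_vecI) (auto simp: lincomb_dim)
    moreover have "?b (z r) \<noteq> 0" using \<open>a r \<noteq> 0\<close> r by (simp add: the_inv_into_f_f[OF z(1)])
    ultimately show False using indpt image_z(2) r unfolding lin_dep_def by auto
  qed
  then show thesis using that[of z] z(2) U(1) unfolding independent_family_def by blast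
qed

lemma mat_of_cols_map_carrier: "mat_of_cols n (map z [0..<m]) \<in> carrier_mat n m"
  using mat_of_cols_carrier(1)[of n "map z [0..<m]"] by simp

lemma mat_of_cols_mult_vec_index:
  fixes z :: "nat \<Rightarrow> 'a::comm_semiring_0 vec"
  assumes "a \<in> carrier_vec m" "i < n"
  shows "(mat_of_cols n (map z [0..<m]) *\<^sub>v a) $ i = (\<Sum>r<m. a $ r * z r $ i)"
  using assms index_mult_mat_vec_sum[OF mat_of_cols_carrier(1), of a "map z [0..<m]" i n]
  by (simp add: mat_of_cols_index mult.commute)

lemma independent_family_imp_det:
  fixes z :: "nat \<Rightarrow> 'a::field vec"
  assumes "independent_family n {..<n} z"
  shows "det (mat_of_cols n (map z [0..<n])) \<noteq> 0"
proof
  let ?Z = "mat_of_cols n (map z [0..<n])"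
  have Z: "?Z \<in> carrier_mat n n" by (rule mat_of_cols_map_carrier)
  assume "det ?Z = 0"
  then obtain a where a: "a \<in> carrier_vec n" "a \<noteq> 0\<^sub>v n" "?Z *\<^sub>v a = 0\<^sub>v n"
    using det_0_iff_vec_prod_zero_field[OF Z] by blast
  have "\<forall>i<n. (\<Sum>r<n. a $ r * z r $ i) = 0"
    using mat_of_cols_mult_vec_index[OF a(1), where z = z] a(3) by (metis index_zero_vec(1))
  then have "\<forall>r<n. a $ r = 0" using assms unfolding independent_family_def by blast
  then show False using a(1,2) by (auto simp: vec_eq_iff)
qed

lemma vspan_eq_carrier_iff:
  fixes S :: "'a::field vec set"
  assumes S: "S \<subseteq> carrier_vec n"
  shows "vspan n S = carrier_vec n \<longleftrightarrow>
    (\<exists>Z\<in>carrier_mat n n. det Z \<noteq> 0 \<and> (\<forall>r<n. col Z r \<in> S))"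
proof
  interpret vec_space "TYPE('a)" n .
  assume full: "vspan n S = carrier_vec n"
  have "vdim n S = n" using full dim_is_n by (simp add: vdim_def cV[symmetric] del: cV)
  then obtain z where z: "\<And>r. r \<in> {..<n} \<Longrightarrow> z r \<in> S" "independent_family n {..<n} z"
    by (metis vdim_obtain_independent_family[OF S] finite_lessThan card_lessThan order_refl)
  let ?Z = "mat_of_cols n (map z [0..<n])"
  have "?Z \<in> carrier_mat n n" by (rule mat_of_cols_map_carrier)
  moreover have "\<forall>r<n. col ?Z r \<in> S" using z(1) S by (auto simp: subset_iff)
  ultimately show "\<exists>Z\<in>carrier_mat n n. det Z \<noteq> 0 \<and> (\<forall>r<n. col Z r \<in> S)"
    using independent_family_imp_det[OF z(2)] by blast
next
  assume "\<exists>Z\<in>carrier_mat n n. det Z \<noteq> 0 \<and> (\<forall>r<n. col Z r \<in> S)"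
  then obtain Z where Z: "Z \<in> carrier_mat n n" "det Z \<noteq> 0" "\<forall>r<n. col Z r \<in> S" by blast
  obtain N where N: "N \<in> carrier_mat n n" "Z * N = 1\<^sub>m n"
    using det_nonzero_obtain_inverse[OF Z(1,2)] by blast
  have "v \<in> vspan n (set (cols Z))" if v: "v \<in> carrier_vec n" for v
  proof -
    have "v = Z *\<^sub>v (N *\<^sub>v v)" using v Z(1) N by (simp flip: assoc_mult_mat_vec)
    then show ?thesis using vspan_cols_iff[OF Z(1)] N(1) v by auto
  qed
  moreover have "set (cols Z) \<subseteq> S" using Z by (auto simp: cols_def)
  ultimately show "vspan n S = carrier_vec n"
    using vspan_mono vspan_subset_carrier[OF S] by blast
qed

lemma vdim_pos:
  fixes S :: "'a::field vec set"
  assumes S: "S \<subseteq> carrier_vec n" and x: "x \<in> S" "x \<noteq> 0\<^sub>v n"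
  shows "1 \<le> vdim n S"
proof (rule ccontr)
  interpret vec_space "TYPE('a)" n .
  assume "\<not> 1 \<le> vdim n S"
  moreover obtain U where "finite U" "card U = vdim n S" "span U = span S"
    by (rule obtain_vdim_basis[OF S])
  ultimately have "span S = span {}" by (metis card_0_eq less_one not_le)
  then have "span S = {0\<^sub>v n}" using span_empty by simp
  then show False using vspan_superset[OF S] x unfolding vspan_def by auto
qed

section \<open>Compactness of the scalar field\<close>

locale normed_conjugation =
  fixes ty :: "'a::{conjugatable_field, real_normed_field} itself"
  assumes conjugate_mult_self: "conjugate (x::'a) * x = of_real ((norm x)\<^sup>2)"
begin

lemma norm_conjugate: "norm (conjugate (x::'a)) = norm x"
proof (cases "x = 0")
  case False
  have "norm (conjugate x) * norm x = norm x * norm x"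
    using arg_cong[OF conjugate_mult_self[of x], of norm] by (simp add: norm_mult power2_eq_square)
  then show ?thesis using False by simp
qed simp

lemma conjugate_fixed_imp_real:
  assumes "conjugate (x::'a) = x"
  obtains a where "x = of_real a"
proof -
  have "x * x = of_real (norm x) * of_real (norm x)"
    using conjugate_mult_self[of x] assms by (simp add: power2_eq_square)
  then have "x = of_real (norm x) \<or> x = of_real (- norm x)" by (simp add: square_eq_iff)
  then show thesis using that by blast
qed

lemma conjugate_diff_conjugate: "conjugate (x - conjugate x) = - (x - conjugate x)" for x :: 'a
  using conjugate_dist_add[of x "- conjugate x"] by (simp add: conjugate_neg)

lemma norm_diff_conjugate_le: "norm (x - conjugate x) \<le> 2 * norm x" for x :: 'a
  using norm_triangle_ineq4[of x "conjugate x"] by (simp add: norm_conjugate)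

lemma obtain_real_part:
  fixes x :: 'a
  obtains a where "x = of_real a + (x - conjugate x) / 2" "\<bar>a\<bar> \<le> norm x"
proof -
  have "conjugate (x + conjugate x) = x + conjugate x"
    by (simp add: conjugate_dist_add add.commute)
  then obtain t where t: "x + conjugate x = of_real t" by (rule conjugate_fixed_imp_real)
  have "\<bar>t\<bar> = norm (x + conjugate x)" by (simp add: t)
  also have "\<dots> \<le> 2 * norm x"
    using norm_triangle_ineq[of x "conjugate x"] by (simp add: norm_conjugate)
  finally have "\<bar>t / 2\<bar> \<le> norm x" by simp
  moreover have "x = of_real (t / 2) + (x - conjugate x) / 2"
    by (simp flip: t add: field_simps)
  ultimately show thesis using that by blast
qed

text \<open>The field is a copy of the reals (with \<open>w = 0\<close>) or of the complex numbers (with \<open>w\<close>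
  imaginary).\<close>

lemma obtain_real_coordinates:
  obtains w :: 'a and c :: real where
    "\<And>x. \<exists>a b. x = of_real a + of_real b * w \<and> \<bar>a\<bar> \<le> c * norm x \<and> \<bar>b\<bar> \<le> c * norm x"
proof (cases "\<exists>u::'a. u \<noteq> 0 \<and> conjugate u = - u")
  case True
  then obtain u :: 'a where u: "u \<noteq> 0" "conjugate u = - u" by blast
  show thesis
  proof (rule that[of "inverse u" "max 1 (norm u)"])
    fix x :: 'a
    obtain a where a: "x = of_real a + (x - conjugate x) / 2" "\<bar>a\<bar> \<le> norm x"
      by (rule obtain_real_part)
    have "conjugate ((x - conjugate x) * u) = (x - conjugate x) * u"
      using u(2) by (simp only: conjugate_dist_mul conjugate_diff_conjugate minus_mult_minus)
    then obtain s where s: "(x - conjugate x) * u = of_real s" by (rule conjugate_fixed_imp_real)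
    have "x - conjugate x = of_real s * inverse u" using u(1) by (simp flip: s)
    then have "x = of_real a + of_real (s / 2) * inverse u" using a(1) by simp
    moreover have "\<bar>s / 2\<bar> \<le> norm u * norm x"
      using arg_cong[OF s, of norm] mult_right_mono[OF norm_diff_conjugate_le[of x], of "norm u"]
      by (simp add: norm_mult mult_ac)
    moreover have "norm x \<le> max 1 (norm u) * norm x" "norm u * norm x \<le> max 1 (norm u) * norm x"
      by (auto intro: mult_right_mono simp: mult_le_cancel_right1)
    ultimately show "\<exists>a b. x = of_real a + of_real b * inverse u \<and>
      \<bar>a\<bar> \<le> max 1 (norm u) * norm x \<and> \<bar>b\<bar> \<le> max 1 (norm u) * norm x"
      using a(2) by (intro exI[of _ a] exI[of _ "s / 2"]) linarith
  qed
next
  case False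
  then have "x - conjugate x = 0" for x :: 'a using conjugate_diff_conjugate by blast
  then have "\<exists>a. x = of_real a \<and> \<bar>a\<bar> \<le> norm x" for x :: 'a
    using obtain_real_part[of x] by (metis add.right_neutral div_0)
  then show thesis
    by (intro that[of 0 1]) (metis abs_zero add_0_right mult_1 mult_zero_right norm_ge_zero)
qed

lemma bounded_obtain_convergent_subseq:
  fixes f :: "nat \<Rightarrow> 'a"
  assumes "\<And>n. norm (f n) \<le> M"
  obtains s where "strict_mono (s :: nat \<Rightarrow> nat)" "convergent (\<lambda>n. f (s n))"
proof -
  obtain w :: 'a and c where
    coords: "\<And>x. \<exists>a b. x = of_real a + of_real b * w \<and> \<bar>a\<bar> \<le> c * norm x \<and> \<bar>b\<bar> \<le> c * norm x"
    by (rule obtain_real_coordinates) blast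
  obtain a b where f: "f n = of_real (a n) + of_real (b n) * w"
    and bounds: "\<bar>a n\<bar> \<le> c * norm (f n)" "\<bar>b n\<bar> \<le> c * norm (f n)" for n
    using coords[of "f _"] by metis
  have "norm (a n, b n) \<le> 2 * \<bar>c\<bar> * M" for n
  proof -
    have "c * norm (f n) \<le> \<bar>c\<bar> * M" using assms[of n] by (intro mult_mono) auto
    then show ?thesis using norm_Pair_le[of "a n" "b n"] bounds[of n] by simp
  qed
  then have "bounded (range (\<lambda>n. (a n, b n)))" by (auto simp: bounded_iff)
  then obtain l s where s: "strict_mono (s :: nat \<Rightarrow> nat)"
    and "((\<lambda>n. (a n, b n)) \<circ> s) \<longlonglongrightarrow> l"
    using bounded_imp_convergent_subsequence by blast
  then have lim: "(\<lambda>n. (a (s n), b (s n))) \<longlonglongrightarrow> l" by (simp add: o_def)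
  have "(\<lambda>n. f (s n)) \<longlonglongrightarrow> of_real (fst l) + of_real (snd l) * w"
    unfolding f using tendsto_fst[OF lim, simplified] tendsto_snd[OF lim, simplified]
      by (intro tendsto_intros)
  then show thesis using that s unfolding convergent_def by blast
qed

lemma bounded_family_obtain_convergent_subseq:
  fixes f :: "'i \<Rightarrow> nat \<Rightarrow> 'a"
  assumes "finite X" "\<And>i n. i \<in> X \<Longrightarrow> norm (f i n) \<le> M"
  obtains s where "strict_mono (s :: nat \<Rightarrow> nat)" "\<And>i. i \<in> X \<Longrightarrow> convergent (\<lambda>n. f i (s n))"
  using assms
proof (induction X arbitrary: thesis)
  case empty
  show ?case using empty.prems(1)[of id] by (simp add: strict_mono_def)
next
  case (insert i X)
  obtain s where s: "strict_mono (s :: nat \<Rightarrow> nat)" "\<And>j. j \<in> X \<Longrightarrow> convergent (\<lambda>n. f j (s n))"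
    using insert.IH insert.prems(2) by auto
  obtain t where t: "strict_mono (t :: nat \<Rightarrow> nat)" "convergent (\<lambda>n. f i (s (t n)))"
    using bounded_obtain_convergent_subseq[of "\<lambda>n. f i (s n)" M] insert.prems(2) by auto
  have "convergent (\<lambda>n. f j (s (t n)))" if "j \<in> X" for j
    using convergent_subseq_convergent[OF s(2)[OF that] t(1)] by (simp add: o_def)
  then show ?case
    using insert.prems(1)[of "\<lambda>n. s (t n)"] strict_mono_o[OF s(1) t(1)] t(2) by (auto simp: o_def)
qed

end

section \<open>Tensor rank\<close>

text \<open>Unlike in \<^const>\<open>is_decomp\<close>, zero columns are allowed, so that the number of terms can be
  padded and decompositions survive mode products.\<close>

definition has_cpd :: "nat \<Rightarrow> nat \<Rightarrow> nat \<Rightarrow> 'a::comm_ring_1 tensor3 \<Rightarrow> nat \<Rightarrow> bool" where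
  "has_cpd I1 I2 I3 T r \<longleftrightarrow>
     (\<exists>A\<in>carrier_mat I1 r. \<exists>B\<in>carrier_mat I2 r. \<exists>C\<in>carrier_mat I3 r. T = cpd I1 I2 I3 r A B C)"

lemma has_cpdI:
  assumes "A \<in> carrier_mat I1 r" "B \<in> carrier_mat I2 r" "C \<in> carrier_mat I3 r"
    "T = cpd I1 I2 I3 r A B C"
  shows "has_cpd I1 I2 I3 T r"
  using assms unfolding has_cpd_def by blast

lemma has_cpdE:
  assumes "has_cpd I1 I2 I3 T r"
  obtains A B C where "A \<in> carrier_mat I1 r" "B \<in> carrier_mat I2 r" "C \<in> carrier_mat I3 r"
    "T = cpd I1 I2 I3 r A B C"
  using assms unfolding has_cpd_def by blast

lemma tensor3_eqI:
  assumes "tensor3_in I1 I2 I3 S" "tensor3_in I1 I2 I3 T"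
    and "\<And>i j k. i < I1 \<Longrightarrow> j < I2 \<Longrightarrow> k < I3 \<Longrightarrow> S i j k = T i j k"
  shows "S = T"
proof (intro ext)
  fix i j k
  show "S i j k = T i j k"
    using assms by (cases "i < I1 \<and> j < I2 \<and> k < I3") (auto simp: tensor3_in_def)
qed

lemma tensor3_in_cpd: "tensor3_in I1 I2 I3 (cpd I1 I2 I3 r A B C)"
  by (auto simp: tensor3_in_def cpd_def)

lemma is_decomp_imp_has_cpd:
  assumes "is_decomp I1 I2 I3 T r A B C"
  shows "has_cpd I1 I2 I3 T r"
  using assms unfolding is_decomp_def by (blast intro: has_cpdI)

lemma has_cpd_if_finite_sum:
  assumes T: "tensor3_in I1 I2 I3 T" and "finite X"
    and sum: "\<And>i j k. i < I1 \<Longrightarrow> j < I2 \<Longrightarrow> k < I3 \<Longrightarrow> T i j k = (\<Sum>x\<in>X. A i x * B j x * C k x)"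
  shows "has_cpd I1 I2 I3 T (card X)"
proof -
  obtain h where h: "bij_betw h {..<card X} X"
    using \<open>finite X\<close> by (metis card_lessThan finite_lessThan finite_same_card_bij)
  let ?M = "\<lambda>n F. mat n (card X) (\<lambda>(i, s). F i (h s))"
  have "T = cpd I1 I2 I3 (card X) (?M I1 A) (?M I2 B) (?M I3 C)"
  proof (rule tensor3_eqI[OF T tensor3_in_cpd])
    fix i j k assume "i < I1" "j < I2" "k < I3"
    then show "T i j k = cpd I1 I2 I3 (card X) (?M I1 A) (?M I2 B) (?M I3 C) i j k"
      using sum sum.reindex_bij_betw[OF h, of "\<lambda>x. A i x * B j x * C k x"] by (simp add: cpd_def)
  qed
  then show ?thesis by (intro has_cpdI[of "?M I1 A" _ _ "?M I2 B" _ "?M I3 C"]) simp_all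
qed

lemma has_cpd_mono:
  assumes "has_cpd I1 I2 I3 T r" "r \<le> r'"
  shows "has_cpd I1 I2 I3 T r'"
proof -
  obtain A B C where T: "T = cpd I1 I2 I3 r A B C" using assms(1) by (rule has_cpdE)
  have "has_cpd I1 I2 I3 T (card {..<r'})"
  proof (rule has_cpd_if_finite_sum)
    fix i j k assume "i < I1" "j < I2" "k < I3"
    then show "T i j k = (\<Sum>s<r'. (if s < r then A $$ (i, s) else 0) * B $$ (j, s) * C $$ (k, s))"
      using assms(2) unfolding T cpd_def
        by (auto intro!: sum.mono_neutral_cong_left split: if_splits)
  qed (simp_all add: T tensor3_in_cpd)
  then show ?thesis by simp
qed

lemma has_cpd_card_entries:
  assumes T: "tensor3_in I1 I2 I3 T"
  shows "has_cpd I1 I2 I3 T (card ({..<I1} \<times> {..<I2}))"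
proof (rule has_cpd_if_finite_sum[OF T])
  fix i j k assume ij: "i < I1" "j < I2"
  have "T i j k = (\<Sum>x\<in>{(i, j)}. of_bool (i = fst x) * of_bool (j = snd x) * T (fst x) (snd x) k)"
    by simp
  also have "\<dots> = (\<Sum>x\<in>{..<I1} \<times> {..<I2}.
      of_bool (i = fst x) * of_bool (j = snd x) * T (fst x) (snd x) k)"
    using ij by (intro sum.mono_neutral_left) auto
  finally show "T i j k = (\<Sum>x\<in>{..<I1} \<times> {..<I2}.
      of_bool (i = fst x) * of_bool (j = snd x) * T (fst x) (snd x) k)" .
qed simp

lemma minimal_cpd_is_decomp:
  fixes T :: "'a::comm_ring_1 tensor3"
  assumes "has_cpd I1 I2 I3 T r" and minimal: "\<And>r'. has_cpd I1 I2 I3 T r' \<Longrightarrow> r \<le> r'"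
  shows "\<exists>A B C. is_decomp I1 I2 I3 T r A B C"
proof -
  obtain A B C where carrier: "A \<in> carrier_mat I1 r" "B \<in> carrier_mat I2 r" "C \<in> carrier_mat I3 r"
    and T: "T = cpd I1 I2 I3 r A B C"
    using assms(1) by (rule has_cpdE)
  have "col A s \<noteq> 0\<^sub>v I1 \<and> col B s \<noteq> 0\<^sub>v I2 \<and> col C s \<noteq> 0\<^sub>v I3" if s: "s < r" for s
  proof (rule ccontr)
    assume "\<not> ?thesis"
    then have zero: "A $$ (i, s) * B $$ (j, s) * C $$ (k, s) = 0"
      if "i < I1" "j < I2" "k < I3" for i j k
      using that s carrier by (auto simp: vec_eq_iff)
    have "has_cpd I1 I2 I3 T (card ({..<r} - {s}))"
    proof (rule has_cpd_if_finite_sum)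
      fix i j k assume "i < I1" "j < I2" "k < I3"
      then show "T i j k = (\<Sum>t\<in>{..<r} - {s}. A $$ (i, t) * B $$ (j, t) * C $$ (k, t))"
        using zero s by (simp add: T cpd_def sum.remove[of "{..<r}" s])
    qed (simp_all add: T tensor3_in_cpd)
    then have "r \<le> card ({..<r} - {s})" by (rule minimal)
    then show False using s by simp
  qed
  then show ?thesis using carrier T unfolding is_decomp_def by blast
qed

lemma tensor_rank_le_iff:
  fixes T :: "'a::comm_ring_1 tensor3"
  assumes T: "tensor3_in I1 I2 I3 T"
  shows "tensor_rank I1 I2 I3 T \<le> r \<longleftrightarrow> has_cpd I1 I2 I3 T r"
proof -
  define m where "m = (LEAST r. has_cpd I1 I2 I3 T r)"
  have m: "has_cpd I1 I2 I3 T m"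
    unfolding m_def using has_cpd_card_entries[OF T] by (rule LeastI)
  have least: "m \<le> r'" if "has_cpd I1 I2 I3 T r'" for r'
      unfolding m_def using that by (rule Least_le)
  have "tensor_rank I1 I2 I3 T = m"
    unfolding tensor_rank_def
    using minimal_cpd_is_decomp[OF m least] least is_decomp_imp_has_cpd
    by (intro Least_equality) blast+
  then show ?thesis using m least has_cpd_mono by blast
qed

section \<open>Mode products and orthogonal compression\<close>

definition mode_products :: "'a mat \<Rightarrow> 'a mat \<Rightarrow> 'a mat \<Rightarrow> 'a::comm_ring_1 tensor3 \<Rightarrow> 'a tensor3" where
  "mode_products U V W T = (\<lambda>a b c. if a < dim_row U \<and> b < dim_row V \<and> c < dim_row W
     then (\<Sum>i<dim_col U. \<Sum>j<dim_col V. \<Sum>k<dim_col W.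
       U $$ (a, i) * V $$ (b, j) * W $$ (c, k) * T i j k)
     else 0)"

lemma tensor3_in_mode_products:
  assumes "U \<in> carrier_mat J1 I1" "V \<in> carrier_mat J2 I2" "W \<in> carrier_mat J3 I3"
  shows "tensor3_in J1 J2 J3 (mode_products U V W T)"
  using assms by (auto simp: tensor3_in_def mode_products_def)

lemma mode_products_cpd:
  fixes U V W :: "'a::comm_ring_1 mat"
  assumes UVW: "U \<in> carrier_mat J1 I1" "V \<in> carrier_mat J2 I2" "W \<in> carrier_mat J3 I3"
    and ABC: "A \<in> carrier_mat I1 r" "B \<in> carrier_mat I2 r" "C \<in> carrier_mat I3 r"
  shows "mode_products U V W (cpd I1 I2 I3 r A B C) = cpd J1 J2 J3 r (U * A) (V * B) (W * C)"
proof (rule tensor3_eqI[OF tensor3_in_mode_products[OF UVW] tensor3_in_cpd])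
  fix a b c assume abc: "a < J1" "b < J2" "c < J3"
  have "mode_products U V W (cpd I1 I2 I3 r A B C) a b c = (\<Sum>i<I1. \<Sum>j<I2. \<Sum>k<I3. \<Sum>s<r.
      (U $$ (a, i) * A $$ (i, s)) * (V $$ (b, j) * B $$ (j, s)) * (W $$ (c, k) * C $$ (k, s)))"
    using UVW abc
    by (auto simp: mode_products_def cpd_def sum_distrib_left mult_ac intro!: sum.cong)
  also have "\<dots> = (\<Sum>s<r. \<Sum>i<I1. \<Sum>j<I2. \<Sum>k<I3.
      (U $$ (a, i) * A $$ (i, s)) * (V $$ (b, j) * B $$ (j, s)) * (W $$ (c, k) * C $$ (k, s)))"
    by (simp only: sum.swap[of _ "{..<r}"])
  also have "\<dots> = cpd J1 J2 J3 r (U * A) (V * B) (W * C) a b c"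
    using UVW ABC abc
    by (simp add: cpd_def index_mult_mat_sum del: index_mult_mat(1)
        flip: sum_distrib_left sum_distrib_right)
  finally show "mode_products U V W (cpd I1 I2 I3 r A B C) a b c
    = cpd J1 J2 J3 r (U * A) (V * B) (W * C) a b c" .
qed

lemma has_cpd_mode_products:
  assumes UVW: "U \<in> carrier_mat J1 I1" "V \<in> carrier_mat J2 I2" "W \<in> carrier_mat J3 I3"
    and T: "has_cpd I1 I2 I3 T r"
  shows "has_cpd J1 J2 J3 (mode_products U V W T) r"
  using T
proof (rule has_cpdE)
  fix A B C assume "A \<in> carrier_mat I1 r" "B \<in> carrier_mat I2 r" "C \<in> carrier_mat I3 r"
    "T = cpd I1 I2 I3 r A B C"
  then show ?thesis
    using UVW by (intro has_cpdI[of "U * A" _ _ "V * B" _ "W * C"]) (auto simp: mode_products_cpd)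
qed

lemma mode_products_comp:
  fixes T :: "'a::comm_ring_1 tensor3"
  assumes UVW: "U \<in> carrier_mat J1 I1" "V \<in> carrier_mat J2 I2" "W \<in> carrier_mat J3 I3"
    and UVW': "U' \<in> carrier_mat L1 J1" "V' \<in> carrier_mat L2 J2" "W' \<in> carrier_mat L3 J3"
    and T: "tensor3_in I1 I2 I3 T"
  shows "mode_products U' V' W' (mode_products U V W T)
    = mode_products (U' * U) (V' * V) (W' * W) T"
proof -
  obtain r A B C where "A \<in> carrier_mat I1 r" "B \<in> carrier_mat I2 r" "C \<in> carrier_mat I3 r"
    "T = cpd I1 I2 I3 r A B C"
    using has_cpd_card_entries[OF T] by (rule has_cpdE)
  then show ?thesis
    using UVW UVW' mode_products_cpd[OF mult_carrier_mat[OF UVW'(1) UVW(1)]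
        mult_carrier_mat[OF UVW'(2) UVW(2)] mult_carrier_mat[OF UVW'(3) UVW(3)]]
    by (simp add: mode_products_cpd[where r = r])
qed

lemma mode_products_fixed_fibers:
  fixes T :: "'a::comm_ring_1 tensor3"
  assumes T: "tensor3_in I1 I2 I3 T"
    and P: "P \<in> carrier_mat I1 I1" "\<And>f. f \<in> fibers1 I1 I2 I3 T \<Longrightarrow> P *\<^sub>v f = f"
    and Q: "Q \<in> carrier_mat I2 I2" "\<And>f. f \<in> fibers2 I1 I2 I3 T \<Longrightarrow> Q *\<^sub>v f = f"
    and S: "S \<in> carrier_mat I3 I3" "\<And>f. f \<in> fibers3 I1 I2 I3 T \<Longrightarrow> S *\<^sub>v f = f"
  shows "mode_products P Q S T = T"
proof (rule tensor3_eqI[OF tensor3_in_mode_products[OF P(1) Q(1) S(1)] T])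
  fix a b c assume abc: "a < I1" "b < I2" "c < I3"
  have fixed_fiber: "(\<Sum>j<n. M $$ (i, j) * f j) = f i"
    if "M \<in> carrier_mat n n" "M *\<^sub>v vec n f = vec n f" "i < n" for n i f and M :: "'a mat"
    using that index_mult_mat_vec_sum[OF that(1) vec_carrier that(3), of f] by simp
  have contract_P: "(\<Sum>i<I1. P $$ (a, i) * T i b c) = T a b c"
    using fixed_fiber[OF P(1) P(2) abc(1), of "\<lambda>i. T i b c"] abc unfolding fibers1_def by blast
  have contract_Q: "(\<Sum>j<I2. Q $$ (b, j) * T i j c) = T i b c" if "i < I1" for i
    using fixed_fiber[OF Q(1) Q(2) abc(2), of "\<lambda>j. T i j c"] abc that unfolding fibers2_def by blast
  have contract_S: "(\<Sum>k<I3. S $$ (c, k) * T i j k) = T i j c" if "i < I1" "j < I2" for i j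
    using fixed_fiber[OF S(1) S(2) abc(3), of "\<lambda>k. T i j k"] that unfolding fibers3_def by blast
  have "mode_products P Q S T a b c
      = (\<Sum>i<I1. P $$ (a, i) * (\<Sum>j<I2. Q $$ (b, j) * (\<Sum>k<I3. S $$ (c, k) * T i j k)))"
    using P(1) Q(1) S(1) abc by (simp add: mode_products_def sum_distrib_left mult_ac)
  then show "mode_products P Q S T a b c = T a b c" by (simp add: contract_P contract_Q contract_S)
qed

lemma compress_eq_mode_products:
  assumes "V1 \<in> carrier_mat I1 R1" "V2 \<in> carrier_mat I2 R2" "V3 \<in> carrier_mat I3 R3"
  shows "compress I1 I2 I3 R1 R2 R3 T V1 V2 V3 = mode_products (adj V1) (adj V2) (adj V3) T"
  using assms by (auto simp: compress_def mode_products_def adj_def fun_eq_iff intro!: sum.cong)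

lemma adj_carrier: "V \<in> carrier_mat n r \<Longrightarrow> adj V \<in> carrier_mat r n"
  by (auto simp: adj_def)

lemma orth_basis_mat_projection:
  assumes V: "orth_basis_mat n r S V" and S: "S \<subseteq> carrier_vec n" and f: "f \<in> S"
  shows "(V * adj V) *\<^sub>v f = f"
proof -
  have V_orth: "V \<in> carrier_mat n r" "adj V * V = 1\<^sub>m r" and "f \<in> vspan n (set (cols V))"
    using V vspan_superset[OF S] f by (auto simp: orth_basis_mat_def)
  then obtain x where x: "x \<in> carrier_vec r" "f = V *\<^sub>v x" using vspan_cols_iff by blast
  have "(V * adj V) *\<^sub>v f = V *\<^sub>v ((adj V * V) *\<^sub>v x)"
    using V_orth(1) x adj_carrier[OF V_orth(1)] by (simp add: assoc_mult_mat_vec[where n\<^sub>2 = n])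
  then show ?thesis using V_orth x by simp
qed

lemma orth_basis_mat_imp_coordinates_span:
  assumes V: "orth_basis_mat n r S V" and A: "A \<in> carrier_mat r m"
    and S: "S \<subseteq> vspan n (set (cols (V * A)))"
  shows "vspan r (set (cols A)) = carrier_vec r"
proof
  have V_orth: "V \<in> carrier_mat n r" "adj V * V = 1\<^sub>m r"
    and span: "vspan n (set (cols V)) = vspan n S"
    using V by (auto simp: orth_basis_mat_def)
  have VA_carrier: "V * A \<in> carrier_mat n m" using V_orth(1) A by simp
  show "carrier_vec r \<subseteq> vspan r (set (cols A))"
  proof
    fix x :: "'a vec" assume x: "x \<in> carrier_vec r"
    have "V *\<^sub>v x \<in> vspan n S" using span vspan_cols_iff[OF V_orth(1)] x by blast
    then have "V *\<^sub>v x \<in> vspan n (set (cols (V * A)))"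
      using vspan_minimal[OF set_cols_subset_carrier[OF VA_carrier] S] by blast
    then obtain y where y: "y \<in> carrier_vec m" "V *\<^sub>v x = (V * A) *\<^sub>v y"
      using vspan_cols_iff[OF VA_carrier] by blast
    have "(adj V * V) *\<^sub>v x = (adj V * V) *\<^sub>v (A *\<^sub>v y)"
      using y V_orth(1) A x adj_carrier[OF V_orth(1)]
      by (simp add: assoc_mult_mat_vec[where n\<^sub>2 = n])
    then have "x = A *\<^sub>v y" using V_orth(2) x A y(1) by simp
    then show "x \<in> vspan r (set (cols A))" using vspan_cols_iff[OF A] y(1) by blast
  qed
qed (rule vspan_subset_carrier[OF set_cols_subset_carrier[OF A]])

lemma fibers1_cpd_subset:
  assumes "A \<in> carrier_mat I1 r"
  shows "fibers1 I1 I2 I3 (cpd I1 I2 I3 r A B C) \<subseteq> vspan I1 (set (cols A))"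
proof -
  have "vec I1 (\<lambda>i. cpd I1 I2 I3 r A B C i j k) = A *\<^sub>v vec r (\<lambda>s. B $$ (j, s) * C $$ (k, s))"
    if "j < I2" "k < I3" for j k
    using that assms index_mult_mat_vec_sum[OF assms vec_carrier]
    by (intro eq_vecI) (auto simp: cpd_def mult.assoc)
  then show ?thesis using vspan_cols_iff[OF assms] by (fastforce simp: fibers1_def)
qed

lemma fibers2_cpd_subset:
  assumes "B \<in> carrier_mat I2 r"
  shows "fibers2 I1 I2 I3 (cpd I1 I2 I3 r A B C) \<subseteq> vspan I2 (set (cols B))"
proof -
  have "vec I2 (\<lambda>j. cpd I1 I2 I3 r A B C i j k) = B *\<^sub>v vec r (\<lambda>s. A $$ (i, s) * C $$ (k, s))"
    if "i < I1" "k < I3" for i k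
    using that assms index_mult_mat_vec_sum[OF assms vec_carrier]
    by (intro eq_vecI) (auto simp: cpd_def mult_ac)
  then show ?thesis using vspan_cols_iff[OF assms] by (fastforce simp: fibers2_def)
qed

locale tensor_compression =
  fixes I1 I2 I3 R1 R2 R3 :: nat and Tp T :: "'a::conjugatable_field tensor3"
    and V1 V2 V3 :: "'a mat"
  assumes Tp_in: "tensor3_in I1 I2 I3 Tp"
    and V1_basis: "orth_basis_mat I1 R1 (fibers1 I1 I2 I3 Tp) V1"
    and V2_basis: "orth_basis_mat I2 R2 (fibers2 I1 I2 I3 Tp) V2"
    and V3_basis: "orth_basis_mat I3 R3 (fibers3 I1 I2 I3 Tp) V3"
    and T_compress: "T = compress I1 I2 I3 R1 R2 R3 Tp V1 V2 V3"
begin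

lemma V_carrier: "V1 \<in> carrier_mat I1 R1" "V2 \<in> carrier_mat I2 R2" "V3 \<in> carrier_mat I3 R3"
  using V1_basis V2_basis V3_basis by (auto simp: orth_basis_mat_def)

lemmas adj_V_carrier = V_carrier[THEN adj_carrier]

lemma T_eq_mode_products: "T = mode_products (adj V1) (adj V2) (adj V3) Tp"
  unfolding T_compress by (rule compress_eq_mode_products[OF V_carrier])

lemma T_in: "tensor3_in R1 R2 R3 T"
  unfolding T_eq_mode_products by (rule tensor3_in_mode_products[OF adj_V_carrier])

lemma Tp_eq_mode_products: "Tp = mode_products V1 V2 V3 T"
proof -
  have "mode_products V1 V2 V3 T = mode_products (V1 * adj V1) (V2 * adj V2) (V3 * adj V3) Tp"
    unfolding T_eq_mode_products by (rule mode_products_comp[OF adj_V_carrier V_carrier Tp_in])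
  also have "\<dots> = Tp"
    using V_carrier adj_V_carrier V1_basis V2_basis V3_basis
    by (intro mode_products_fixed_fibers[OF Tp_in] mult_carrier_mat orth_basis_mat_projection)
      (auto simp: fibers1_def fibers2_def fibers3_def)
  finally show ?thesis by simp
qed

lemma has_cpd_compression_iff: "has_cpd R1 R2 R3 T r \<longleftrightarrow> has_cpd I1 I2 I3 Tp r"
proof
  assume "has_cpd R1 R2 R3 T r"
  then show "has_cpd I1 I2 I3 Tp r"
    by (subst Tp_eq_mode_products) (rule has_cpd_mode_products[OF V_carrier])
next
  assume "has_cpd I1 I2 I3 Tp r"
  then show "has_cpd R1 R2 R3 T r"
    unfolding T_eq_mode_products by (rule has_cpd_mode_products[OF adj_V_carrier])
qed

lemma cpd_factors_span:
  assumes ABC: "A \<in> carrier_mat R1 r" "B \<in> carrier_mat R2 r" "C \<in> carrier_mat R3 r"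
    and T: "T = cpd R1 R2 R3 r A B C"
  shows "vspan R1 (set (cols A)) = carrier_vec R1" "vspan R2 (set (cols B)) = carrier_vec R2"
proof -
  have Tp: "Tp = cpd I1 I2 I3 r (V1 * A) (V2 * B) (V3 * C)"
    using Tp_eq_mode_products mode_products_cpd[OF V_carrier ABC] T by simp
  show "vspan R1 (set (cols A)) = carrier_vec R1"
    using orth_basis_mat_imp_coordinates_span[OF V1_basis ABC(1)]
      fibers1_cpd_subset[OF mult_carrier_mat[OF V_carrier(1) ABC(1)]] Tp by metis
  show "vspan R2 (set (cols B)) = carrier_vec R2"
    using orth_basis_mat_imp_coordinates_span[OF V2_basis ABC(2)]
      fibers2_cpd_subset[OF mult_carrier_mat[OF V_carrier(2) ABC(2)]] Tp by metis
qed

lemma has_cpd_imp_le: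
  assumes "has_cpd R1 R2 R3 T r"
  shows "R1 \<le> r"
  using assms
proof (rule has_cpdE)
  fix A B C assume A: "A \<in> carrier_mat R1 r" and "B \<in> carrier_mat R2 r" "C \<in> carrier_mat R3 r"
    "T = cpd R1 R2 R3 r A B C"
  then have "vspan R1 (set (cols A)) = carrier_vec R1" by (rule cpd_factors_span(1))
  with A show "R1 \<le> r" by (rule cols_span_carrier_imp_le)
qed

end

section \<open>Joint generalized eigenvectors\<close>

lemma slice_carrier: "slice R T l \<in> carrier_mat R R"
  by (simp add: slice_def)

lemma slice_comb_carrier: "slice_comb R K T \<gamma> \<in> carrier_mat R R"
  by (simp add: slice_comb_def)

lemma slice_eq_slice_comb:
  fixes T :: "'a::comm_ring_1 tensor3"
  assumes "l < K"
  shows "slice R T l = slice_comb R K T (unit_vec K l)"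
proof -
  have "(\<Sum>k<K. unit_vec K l $ k * T i j k) = T i j l" for i j
    using assms by (subst sum.remove[of _ l]) (auto intro!: sum.neutral)
  then show ?thesis by (simp add: slice_def slice_comb_def)
qed

lemma lin_form_unit_vec:
  assumes "l < K"
  shows "lin_form K v (unit_vec K l) = v $ l"
  using assms by (subst lin_form_def, subst sum.remove[of _ l]) (auto intro!: sum.neutral)

lemma lin_form_smult: "v \<in> carrier_vec K \<Longrightarrow> lin_form K (c \<cdot>\<^sub>v v) \<gamma> = c * lin_form K v \<gamma>"
  by (simp add: lin_form_def sum_distrib_left mult.assoc)

lemma lin_form_minus:
  fixes v w :: "'a::comm_ring_1 vec"
  shows "v \<in> carrier_vec K \<Longrightarrow> w \<in> carrier_vec K \<Longrightarrow>
    lin_form K (v - w) \<gamma> = lin_form K v \<gamma> - lin_form K w \<gamma>"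
  by (simp add: lin_form_def sum_subtractf algebra_simps)

lemma slice_comb_cpd:
  fixes A B C :: "'a::comm_ring_1 mat"
  assumes A: "A \<in> carrier_mat R r" and B: "B \<in> carrier_mat R r" and C: "C \<in> carrier_mat K r"
  shows "slice_comb R K (cpd R R K r A B C) \<gamma>
    = A * mat_diag r (\<lambda>s. lin_form K (col C s) \<gamma>) * transpose_mat B"
proof (rule eq_matI)
  let ?d = "\<lambda>s. lin_form K (col C s) \<gamma>"
  fix i j assume "i < dim_row (A * mat_diag r ?d * transpose_mat B)"
    "j < dim_col (A * mat_diag r ?d * transpose_mat B)"
  then have ij: "i < R" "j < R" using A B by auto
  have "slice_comb R K (cpd R R K r A B C) \<gamma> $$ (i, j)
      = (\<Sum>k<K. \<Sum>s<r. A $$ (i, s) * (C $$ (k, s) * \<gamma> $ k) * B $$ (j, s))"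
    using ij by (auto simp: slice_comb_def cpd_def sum_distrib_left mult_ac intro!: sum.cong)
  also have "\<dots> = (\<Sum>s<r. \<Sum>k<K. A $$ (i, s) * (C $$ (k, s) * \<gamma> $ k) * B $$ (j, s))"
    by (rule sum.swap)
  also have "\<dots> = (\<Sum>s<r. A $$ (i, s) * ?d s * B $$ (j, s))"
    using C by (simp add: lin_form_def sum_distrib_left sum_distrib_right)
  also have "\<dots> = (A * mat_diag r ?d * transpose_mat B) $$ (i, j)"
    using A B ij
    by (simp add: mat_diag_mult_right[OF A] index_mult_mat_sum[of _ R r _ R]
        del: index_mult_mat(1))
  finally show "slice_comb R K (cpd R R K r A B C) \<gamma> $$ (i, j)
    = (A * mat_diag r ?d * transpose_mat B) $$ (i, j)" .
qed (use A B in \<open>auto simp: slice_comb_def\<close>)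

lemma slice_cpd:
  fixes A B C :: "'a::comm_ring_1 mat"
  assumes ABC: "A \<in> carrier_mat R r" "B \<in> carrier_mat R r" "C \<in> carrier_mat K r" and l: "l < K"
  shows "slice R (cpd R R K r A B C) l = A * mat_diag r (\<lambda>s. C $$ (l, s)) * transpose_mat B"
proof -
  have "mat_diag r (\<lambda>s. lin_form K (col C s) (unit_vec K l)) = mat_diag r (\<lambda>s. C $$ (l, s))"
    using ABC(3) l by (intro eq_matI) (auto simp: mat_diag_def lin_form_unit_vec)
  then show ?thesis using slice_comb_cpd[OF ABC] slice_eq_slice_comb[OF l] by metis
qed

lemma tensor3_eqI_slices:
  assumes "tensor3_in R R K S" "tensor3_in R R K T" "\<And>l. l < K \<Longrightarrow> slice R S l = slice R T l"
  shows "S = T"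
proof (rule tensor3_eqI[OF assms(1,2)])
  fix i j k assume "i < R" "j < R" "k < K"
  then show "S i j k = T i j k"
    using arg_cong[OF assms(3), of k "\<lambda>M. M $$ (i, j)"] by (simp add: slice_def)
qed

lemma slice_comb_mult_vec_index:
  fixes T :: "'a::comm_ring_1 tensor3"
  assumes x: "x \<in> carrier_vec R" and i: "i < R"
  shows "(slice_comb R K T \<gamma> *\<^sub>v x) $ i = (\<Sum>k<K. \<gamma> $ k * (slice R T k *\<^sub>v x) $ i)"
proof -
  have slice: "(slice R T k *\<^sub>v x) $ i = (\<Sum>j<R. T i j k * x $ j)" for k
    using index_mult_mat_vec_sum[OF slice_carrier x i] i
    by (simp add: slice_def del: index_mult_mat_vec)
  have "(slice_comb R K T \<gamma> *\<^sub>v x) $ i = (\<Sum>j<R. \<Sum>k<K. \<gamma> $ k * (T i j k * x $ j))"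
    using index_mult_mat_vec_sum[OF slice_comb_carrier x i, of K T \<gamma>] i
    by (simp add: slice_comb_def sum_distrib_right mult.assoc)
  also have "\<dots> = (\<Sum>k<K. \<gamma> $ k * (slice R T k *\<^sub>v x) $ i)"
    unfolding slice by (subst sum.swap) (simp add: sum_distrib_left)
  finally show ?thesis .
qed

lemma slice_comb_mult_vec_eq_lin_form:
  fixes T :: "'a::comm_ring_1 tensor3"
  assumes x: "x \<in> carrier_vec R" and y: "y \<in> carrier_vec R"
    and eq: "\<And>l. l < K \<Longrightarrow> slice R T l *\<^sub>v x = lam $ l \<cdot>\<^sub>v y"
  shows "slice_comb R K T \<gamma> *\<^sub>v x = lin_form K lam \<gamma> \<cdot>\<^sub>v y"
proof (rule eq_vecI)
  fix i assume "i < dim_vec (lin_form K lam \<gamma> \<cdot>\<^sub>v y)"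
  then have i: "i < R" using y by simp
  have "(slice_comb R K T \<gamma> *\<^sub>v x) $ i = (\<Sum>k<K. \<gamma> $ k * (lam $ k * y $ i))"
    using slice_comb_mult_vec_index[OF x i, of K T \<gamma>] eq y i by simp
  then show "(slice_comb R K T \<gamma> *\<^sub>v x) $ i = (lin_form K lam \<gamma> \<cdot>\<^sub>v y) $ i"
    using y i by (simp add: lin_form_def sum_distrib_left mult_ac)
qed (use y in \<open>simp add: slice_comb_def\<close>)

lemma jge_pairI:
  assumes "x \<in> carrier_vec R" "x \<noteq> 0\<^sub>v R" "y \<in> carrier_vec R" "y \<noteq> 0\<^sub>v R" "lam \<in> carrier_vec K"
    and "\<And>l. l < K \<Longrightarrow> slice R T l *\<^sub>v x = lam $ l \<cdot>\<^sub>v y"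
  shows "jge_pair R K T (vspan K {lam}) x"
  using assms unfolding jge_pair_def by blast

lemma jge_pairE:
  assumes "jge_pair R K T L x"
  obtains lam y where "x \<in> carrier_vec R" "x \<noteq> 0\<^sub>v R" "y \<in> carrier_vec R" "y \<noteq> 0\<^sub>v R"
    "lam \<in> carrier_vec K" "L = vspan K {lam}"
    "\<And>l. l < K \<Longrightarrow> slice R T l *\<^sub>v x = lam $ l \<cdot>\<^sub>v y"
  using assms unfolding jge_pair_def by blast

lemma jge_vectors_subset_carrier: "{x. jge_vector R K T x} \<subseteq> carrier_vec R"
  and jge_pairs_subset_carrier: "{x. jge_pair R K T L x} \<subseteq> carrier_vec R"
  by (auto simp: jge_vector_def jge_pair_def)

lemma slice_mix_invertible_iff:
  fixes T :: "'a::field tensor3"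
  shows "slice_mix_invertible R K T \<longleftrightarrow> (\<exists>\<gamma>\<in>carrier_vec K. char_poly_fun R K T \<gamma> \<noteq> 0)"
  unfolding slice_mix_invertible_def char_poly_fun_def
    invertible_mat_iff_det[OF slice_comb_carrier] ..

lemma slice_comb_mult_vec_eq_0_iff:
  fixes T :: "'a::field tensor3"
  assumes "char_poly_fun R K T \<gamma> \<noteq> 0" "x \<in> carrier_vec R"
  shows "slice_comb R K T \<gamma> *\<^sub>v x = 0\<^sub>v R \<longleftrightarrow> x = 0\<^sub>v R"
  using assms det_nonzero_mult_vec_eq_0_iff[OF slice_comb_carrier] by (simp add: char_poly_fun_def)

lemma slice_comb_mult_vec_carrier: "slice_comb R K T \<gamma> *\<^sub>v x \<in> carrier_vec R"
  by (rule carrier_vecI) (simp add: slice_comb_def)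

lemma jge_relation_imp_lin_form_nonzero:
  fixes T :: "'a::field tensor3"
  assumes char: "char_poly_fun R K T \<gamma> \<noteq> 0"
    and x: "x \<in> carrier_vec R" "x \<noteq> 0\<^sub>v R" and lam: "lam \<in> carrier_vec K" "lam \<noteq> 0\<^sub>v K"
    and relation: "\<And>l. l < K \<Longrightarrow> lin_form K lam \<gamma> \<cdot>\<^sub>v (slice R T l *\<^sub>v x)
      = lam $ l \<cdot>\<^sub>v (slice_comb R K T \<gamma> *\<^sub>v x)"
  shows "lin_form K lam \<gamma> \<noteq> 0"
proof
  assume zero: "lin_form K lam \<gamma> = 0"
  let ?N = "slice_comb R K T \<gamma>"
  have "?N *\<^sub>v x \<noteq> 0\<^sub>v R" using slice_comb_mult_vec_eq_0_iff[OF char x(1)] x(2) by simp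
  then obtain i where i: "i < R" "(?N *\<^sub>v x) $ i \<noteq> 0"
    using eq_vecI[of "?N *\<^sub>v x" "0\<^sub>v R"] slice_comb_carrier[of R K T \<gamma>] by auto
  have "lam $ l = 0" if "l < K" for l
    using arg_cong[OF relation[OF that], of "\<lambda>v. v $ i"] zero i
    by (simp add: carrier_matD(1)[OF slice_carrier] carrier_matD(1)[OF slice_comb_carrier]
        del: index_mult_mat_vec)
  then show False using lam by (auto simp: vec_eq_iff)
qed

text \<open>When the mix is invertible, this describes JGE pairs by a closed condition, free of the
  vector \<open>y\<close> in their definition.\<close>

lemma jge_pair_iff_slice_comb:
  fixes T :: "'a::field tensor3"
  assumes char: "char_poly_fun R K T \<gamma> \<noteq> 0" and lam: "lam \<in> carrier_vec K"
  shows "jge_pair R K T (vspan K {lam}) x \<longleftrightarrow> x \<in> carrier_vec R \<and> x \<noteq> 0\<^sub>v R \<and> lam \<noteq> 0\<^sub>v K \<and>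
    (\<forall>l<K. lin_form K lam \<gamma> \<cdot>\<^sub>v (slice R T l *\<^sub>v x) = lam $ l \<cdot>\<^sub>v (slice_comb R K T \<gamma> *\<^sub>v x))"
    (is "?pair \<longleftrightarrow> ?closed")
proof
  assume ?pair
  then obtain lam' y where x: "x \<in> carrier_vec R" "x \<noteq> 0\<^sub>v R" and y: "y \<in> carrier_vec R"
    and lam': "lam' \<in> carrier_vec K" "vspan K {lam} = vspan K {lam'}"
    and eq: "\<And>l. l < K \<Longrightarrow> slice R T l *\<^sub>v x = lam' $ l \<cdot>\<^sub>v y"
    by (rule jge_pairE) blast
  have mix_x: "slice_comb R K T \<gamma> *\<^sub>v x = lin_form K lam' \<gamma> \<cdot>\<^sub>v y"
    using x(1) y eq by (rule slice_comb_mult_vec_eq_lin_form)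
  then have "lin_form K lam' \<gamma> \<noteq> 0" using slice_comb_mult_vec_eq_0_iff[OF char x(1)] x(2) y by auto
  then have "lam' \<noteq> 0\<^sub>v K" by (auto simp: lin_form_def)
  then obtain c where c: "c \<noteq> 0" "lam' = c \<cdot>\<^sub>v lam"
    using vspan_singleton_eq_iff[OF lam lam'(1)] lam'(2) by auto
  have "lin_form K lam \<gamma> \<cdot>\<^sub>v (slice R T l *\<^sub>v x) = lam $ l \<cdot>\<^sub>v (slice_comb R K T \<gamma> *\<^sub>v x)"
    if "l < K" for l
    using eq[OF that] that lam mix_x c(2) by (simp add: lin_form_smult smult_smult_assoc mult_ac)
  moreover have "lam \<noteq> 0\<^sub>v K" using c \<open>lam' \<noteq> 0\<^sub>v K\<close> by auto
  ultimately show ?closed using x by blast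
next
  assume closed: ?closed
  then have nz: "lin_form K lam \<gamma> \<noteq> 0" using jge_relation_imp_lin_form_nonzero[OF char] lam by blast
  let ?y = "inverse (lin_form K lam \<gamma>) \<cdot>\<^sub>v (slice_comb R K T \<gamma> *\<^sub>v x)"
  have y: "?y \<in> carrier_vec R" by (simp add: slice_comb_mult_vec_carrier)
  have "slice_comb R K T \<gamma> *\<^sub>v x = lin_form K lam \<gamma> \<cdot>\<^sub>v ?y"
    using nz by (simp add: smult_smult_assoc)
  then have "?y \<noteq> 0\<^sub>v R" using slice_comb_mult_vec_eq_0_iff[OF char, of x] closed by auto
  moreover have "slice R T l *\<^sub>v x = lam $ l \<cdot>\<^sub>v ?y" if "l < K" for l
  proof -
    have "slice R T l *\<^sub>v x = (lam $ l / lin_form K lam \<gamma>) \<cdot>\<^sub>v (slice_comb R K T \<gamma> *\<^sub>v x)"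
      using nz closed that by (intro smult_vec_eq_imp_eq_divide) auto
    then show ?thesis by (simp add: smult_smult_assoc divide_inverse)
  qed
  ultimately show ?pair using closed y lam by (intro jge_pairI[where y = ?y]) auto
qed

lemma
  fixes T :: "'a::field tensor3"
  assumes char: "char_poly_fun R K T \<gamma> \<noteq> 0" and lam: "lam \<in> carrier_vec K"
    and pair: "jge_pair R K T (vspan K {lam}) x"
  shows jge_pair_imp_lin_form_nonzero: "lin_form K lam \<gamma> \<noteq> 0"
    and slice_mult_jge_vector: "l < K \<Longrightarrow>
      slice R T l *\<^sub>v x = (lam $ l / lin_form K lam \<gamma>) \<cdot>\<^sub>v (slice_comb R K T \<gamma> *\<^sub>v x)"
proof -
  have closed: "x \<in> carrier_vec R" "x \<noteq> 0\<^sub>v R" "lam \<noteq> 0\<^sub>v K" "\<And>l. l < K \<Longrightarrow>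
      lin_form K lam \<gamma> \<cdot>\<^sub>v (slice R T l *\<^sub>v x) = lam $ l \<cdot>\<^sub>v (slice_comb R K T \<gamma> *\<^sub>v x)"
    using pair jge_pair_iff_slice_comb[OF char lam] by auto
  then show nonzero: "lin_form K lam \<gamma> \<noteq> 0"
    using jge_relation_imp_lin_form_nonzero[OF char] lam by blast
  show "slice R T l *\<^sub>v x = (lam $ l / lin_form K lam \<gamma>) \<cdot>\<^sub>v (slice_comb R K T \<gamma> *\<^sub>v x)" if "l < K"
    using nonzero closed(4)[OF that] by (rule smult_vec_eq_imp_eq_divide)
qed

lemma jge_pair_cpd:
  fixes A B C X :: "'a::field mat"
  assumes ABC: "A \<in> carrier_mat R R" "B \<in> carrier_mat R R" "C \<in> carrier_mat K R" and A: "det A \<noteq> 0"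
    and X: "X \<in> carrier_mat R R" "transpose_mat B * X = 1\<^sub>m R" and r: "r < R"
  shows "jge_pair R K (cpd R R K R A B C) (vspan K {col C r}) (col X r)"
proof (rule jge_pairI)
  have B_mult_X: "transpose_mat B *\<^sub>v col X r = unit_vec R r"
    using col_mult2[of "transpose_mat B" R R X R r] ABC(2) X r by simp
  show "col X r \<noteq> 0\<^sub>v R"
  proof
    assume "col X r = 0\<^sub>v R"
    then have "transpose_mat B *\<^sub>v col X r = 0\<^sub>v R" using ABC(2) by (simp add: mult_mat_zero_vec)
    then show False using B_mult_X r by simp
  qed
  have A_unit: "A *\<^sub>v unit_vec R r = col A r" using mult_unit_vec_eq_col[OF ABC(1) r] .
  then show "col A r \<noteq> 0\<^sub>v R"
    using det_nonzero_mult_vec_eq_0_iff[OF ABC(1) A, of "unit_vec R r"] r by auto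
  fix l assume l: "l < K"
  have "mat_diag R (\<lambda>s. C $$ (l, s)) *\<^sub>v unit_vec R r = col C r $ l \<cdot>\<^sub>v unit_vec R r"
    using ABC(3) l r by (subst mult_unit_vec_eq_col[OF mat_diag_dim r]) (auto simp: mat_diag_def)
  then show "slice R (cpd R R K R A B C) l *\<^sub>v col X r = col C r $ l \<cdot>\<^sub>v col A r"
    using ABC X(1) r slice_cpd[OF ABC l] B_mult_X A_unit
    by (simp add: assoc_mult_mat_vec[of _ R R _ R] mult_mat_vec[of _ R R])
qed (use ABC X r in auto)

lemma jge_pair_cpd_imp_value:
  fixes A B C :: "'a::field mat"
  assumes ABC: "A \<in> carrier_mat R R" "B \<in> carrier_mat R R" "C \<in> carrier_mat K R"
    and det: "det A \<noteq> 0" "det B \<noteq> 0" and C: "\<And>r. r < R \<Longrightarrow> col C r \<noteq> 0\<^sub>v K"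
    and jge: "jge_pair R K (cpd R R K R A B C) L x"
  shows "\<exists>r<R. L = vspan K {col C r}"
proof -
  obtain lam y where x: "x \<in> carrier_vec R" "x \<noteq> 0\<^sub>v R" and y: "y \<in> carrier_vec R"
    and lam: "lam \<in> carrier_vec K" "L = vspan K {lam}"
    and eq: "\<And>l. l < K \<Longrightarrow> slice R (cpd R R K R A B C) l *\<^sub>v x = lam $ l \<cdot>\<^sub>v y"
    using jge by (rule jge_pairE) blast
  obtain N where N: "N \<in> carrier_mat R R" "N * A = 1\<^sub>m R"
    using det_nonzero_obtain_inverse[OF ABC(1) det(1)] by blast
  define z where "z = transpose_mat B *\<^sub>v x"
  have z: "z \<in> carrier_vec R" using ABC(2) x by (simp add: z_def)
  have "z \<noteq> 0\<^sub>v R"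
    using det_nonzero_mult_vec_eq_0_iff[of "transpose_mat B" R x] ABC(2) det(2) x
    by (simp add: z_def det_transpose)
  then obtain r where r: "r < R" "z $ r \<noteq> 0" using z by (auto simp: vec_eq_iff)
  have "mat_diag R (\<lambda>s. C $$ (l, s)) *\<^sub>v z = lam $ l \<cdot>\<^sub>v (N *\<^sub>v y)" if l: "l < K" for l
  proof -
    have "mat_diag R (\<lambda>s. C $$ (l, s)) *\<^sub>v z = N *\<^sub>v (A *\<^sub>v (mat_diag R (\<lambda>s. C $$ (l, s)) *\<^sub>v z))"
      using N ABC(1) z by (simp add: mat_diag_mult_vec flip: assoc_mult_mat_vec[of N R R A R])
    also have "\<dots> = N *\<^sub>v (lam $ l \<cdot>\<^sub>v y)"
      using eq[OF l] slice_cpd[OF ABC l] ABC x by (simp add: z_def assoc_mult_mat_vec[of _ R R _ R])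
    finally show ?thesis using N y by (simp add: mult_mat_vec[of _ R R])
  qed
  then have "C $$ (l, r) * z $ r = lam $ l * (N *\<^sub>v y) $ r" if "l < K" for l
    using that arg_cong[of _ _ "\<lambda>v. v $ r"] N(1) r(1)
    by (fastforce simp: mat_diag_mult_vec[OF z] simp del: index_mult_mat_vec)
  then have col: "col C r = ((N *\<^sub>v y) $ r / z $ r) \<cdot>\<^sub>v lam"
    using r ABC(3) lam(1) by (intro eq_vecI) (auto simp: field_simps simp del: index_mult_mat_vec)
  then have "(N *\<^sub>v y) $ r / z $ r \<noteq> 0" using C[OF r(1)] lam(1) by force
  then have "vspan K {col C r} = vspan K {lam}"
    using vspan_singleton_eq_iff[OF lam(1) col_carrier_vec[OF r(1) ABC(3)] C[OF r(1)]] col by blast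
  then show ?thesis using r(1) lam(2) by blast
qed

lemma jge_vectors_span_imp_has_cpd:
  fixes T :: "'a::field tensor3"
  assumes T: "tensor3_in R R K T" and full: "vspan R {x. jge_vector R K T x} = carrier_vec R"
  shows "has_cpd R R K T R"
proof -
  obtain Z where Z: "Z \<in> carrier_mat R R" "det Z \<noteq> 0" "\<And>r. r < R \<Longrightarrow> jge_vector R K T (col Z r)"
    using full unfolding vspan_eq_carrier_iff[OF jge_vectors_subset_carrier] by blast
  obtain N where N: "N \<in> carrier_mat R R" "Z * N = 1\<^sub>m R"
    using det_nonzero_obtain_inverse[OF Z(1,2)] by blast
  have "\<exists>lam y. r < R \<longrightarrow> y \<in> carrier_vec R \<and> (\<forall>l<K. slice R T l *\<^sub>v col Z r = lam $ l \<cdot>\<^sub>v y)" for r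
    using Z(3)[of r] unfolding jge_vector_def jge_pair_def by blast
  then obtain lam y where y: "\<And>r. r < R \<Longrightarrow> y r \<in> carrier_vec R"
    and eq: "\<And>r l. r < R \<Longrightarrow> l < K \<Longrightarrow> slice R T l *\<^sub>v col Z r = lam r $ l \<cdot>\<^sub>v y r"
    by metis
  define A where "A = mat R R (\<lambda>(i, r). y r $ i)"
  define C where "C = mat K R (\<lambda>(l, r). lam r $ l)"
  have AC: "A \<in> carrier_mat R R" "C \<in> carrier_mat K R" by (simp_all add: A_def C_def)
  have "slice R T l = slice R (cpd R R K R A (transpose_mat N) C) l" if l: "l < K" for l
  proof -
    have "slice R T l * Z = A * mat_diag R (\<lambda>s. C $$ (l, s))"
    proof (rule eq_matI)
      fix i r assume "i < dim_row (A * mat_diag R (\<lambda>s. C $$ (l, s)))"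
        "r < dim_col (A * mat_diag R (\<lambda>s. C $$ (l, s)))"
      then have ir: "i < R" "r < R" using AC by (auto simp: mat_diag_def)
      have "(slice R T l * Z) $$ (i, r) = (slice R T l *\<^sub>v col Z r) $ i"
        using ir Z(1) slice_carrier[of R T l] by auto
      then show "(slice R T l * Z) $$ (i, r) = (A * mat_diag R (\<lambda>s. C $$ (l, s))) $$ (i, r)"
        using ir l y[of r] eq[of r l] unfolding mat_diag_mult_right[OF AC(1)]
        by (simp add: A_def C_def mult.commute)
    qed (use AC(1) Z(1) slice_carrier[of R T l] in \<open>auto simp: mat_diag_def\<close>)
    then have "slice R T l * (Z * N) = A * mat_diag R (\<lambda>s. C $$ (l, s)) * N"
      using assoc_mult_mat[OF slice_carrier Z(1) N(1)] by metis
    then show ?thesis using N AC slice_cpd[OF AC(1) _ AC(2) l, of "transpose_mat N"]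
      by (simp add: right_mult_one_mat[OF slice_carrier])
  qed
  then have "T = cpd R R K R A (transpose_mat N) C"
    by (rule tensor3_eqI_slices[OF T tensor3_in_cpd])
  then show ?thesis using AC N(1) by (intro has_cpdI[of A _ _ "transpose_mat N" _ C]) simp_all
qed

locale square_tensor_compression = tensor_compression I1 I2 I3 R R K Tp T V1 V2 V3
  for I1 I2 I3 R K :: nat and Tp T :: "'a::conjugatable_field tensor3" and V1 V2 V3 :: "'a mat"
begin

lemma cpd_factors_det_nonzero:
  assumes "A \<in> carrier_mat R R" "B \<in> carrier_mat R R" "C \<in> carrier_mat K R" "T = cpd R R K R A B C"
  shows "det A \<noteq> 0" "det B \<noteq> 0"
  using cpd_factors_span[OF assms] cols_span_carrier_imp_det assms by blast+

lemma has_cpd_iff_jge_vectors_span: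
  "has_cpd R R K T R \<longleftrightarrow> vspan R {x. jge_vector R K T x} = carrier_vec R"
proof
  assume "has_cpd R R K T R"
  then obtain A B C where ABC: "A \<in> carrier_mat R R" "B \<in> carrier_mat R R" "C \<in> carrier_mat K R"
    and T: "T = cpd R R K R A B C" by (rule has_cpdE)
  note det = cpd_factors_det_nonzero[OF ABC T]
  obtain X where X: "X \<in> carrier_mat R R" "transpose_mat B * X = 1\<^sub>m R" and "det X \<noteq> 0"
    using det_nonzero_obtain_dual[OF ABC(2) det(2)] by blast
  moreover have "jge_vector R K T (col X r)" if "r < R" for r
    using jge_pair_cpd[OF ABC det(1) X that] T unfolding jge_vector_def by blast
  ultimately show "vspan R {x. jge_vector R K T x} = carrier_vec R"
    unfolding vspan_eq_carrier_iff[OF jge_vectors_subset_carrier] using X(1) by blast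
qed (rule jge_vectors_span_imp_has_cpd[OF T_in])

lemma jge_values_and_vectors_of_decomp:
  assumes decomp: "is_decomp R R K T R A B C"
  shows "{L. jge_value R K T L} = {vspan K {col C r} | r. r < R}" and "invertible_mat B"
    and "X \<in> carrier_mat R R \<Longrightarrow> transpose_mat B * X = 1\<^sub>m R \<Longrightarrow> r < R \<Longrightarrow> jge_vector R K T (col X r)"
proof -
  have ABC: "A \<in> carrier_mat R R" "B \<in> carrier_mat R R" "C \<in> carrier_mat K R"
    and C: "\<And>r. r < R \<Longrightarrow> col C r \<noteq> 0\<^sub>v K" and T: "T = cpd R R K R A B C"
    using decomp unfolding is_decomp_def by blast+
  note det = cpd_factors_det_nonzero[OF ABC T]
  note pair = jge_pair_cpd[OF ABC det(1), folded T]
  then show "X \<in> carrier_mat R R \<Longrightarrow> transpose_mat B * X = 1\<^sub>m R \<Longrightarrow> r < R \<Longrightarrow> jge_vector R K T (col X r)"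
    unfolding jge_vector_def by blast
  show "invertible_mat B" using invertible_mat_iff_det[OF ABC(2)] det(2) by simp
  obtain X where "X \<in> carrier_mat R R" "transpose_mat B * X = 1\<^sub>m R"
    using det_nonzero_obtain_dual[OF ABC(2) det(2)] by blast
  then show "{L. jge_value R K T L} = {vspan K {col C r} | r. r < R}"
    using pair jge_pair_cpd_imp_value[OF ABC det C, folded T] unfolding jge_value_def by blast
qed

end

lemma orth_compression_imp_square_tensor_compression:
  assumes "orth_compression I1 I2 I3 R R K Tp T" "tensor3_in I1 I2 I3 Tp"
  shows "\<exists>V1 V2 V3. square_tensor_compression I1 I2 I3 R K Tp T V1 V2 V3"
  using assms unfolding orth_compression_def
  by (blast intro: square_tensor_compression.intro tensor_compression.intro)

section \<open>The characteristic polynomial and algebraic multiplicities\<close>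

lemma det_mat_diag:
  fixes f :: "nat \<Rightarrow> 'a::comm_ring_1"
  shows "det (mat_diag n f) = (\<Prod>i<n. f i)"
proof -
  have "det (mat_diag n f) = prod_list (diag_mat (mat_diag n f))"
    by (rule det_upper_triangular[of _ n]) (auto simp: mat_diag_def)
  also have "diag_mat (mat_diag n f) = map f [0..<n]" by (auto simp: diag_mat_def mat_diag_def)
  finally show ?thesis by (simp add: prod.distinct_set_conv_list[symmetric] lessThan_atLeast0)
qed

lemma char_poly_fun_cpd:
  fixes A B C :: "'a::comm_ring_1 mat"
  assumes ABC: "A \<in> carrier_mat R R" "B \<in> carrier_mat R R" "C \<in> carrier_mat K R"
  shows "char_poly_fun R K (cpd R R K R A B C) \<gamma>
    = det A * (\<Prod>s<R. lin_form K (col C s) \<gamma>) * det B"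
proof -
  have "det (A * mat_diag R d * transpose_mat B) = det A * det (mat_diag R d) * det B" for d
    using ABC(1,2) by (simp add: det_mult[of _ R] det_transpose mult_carrier_mat[of _ R R])
  then show ?thesis unfolding char_poly_fun_def slice_comb_cpd[OF ABC] by (simp add: det_mat_diag)
qed

lemma mpoly_fun_indexed:
  fixes f :: "'a::comm_ring_1 vec \<Rightarrow> 'a"
  assumes X: "finite X"
    and f: "\<And>\<gamma>. \<gamma> \<in> carrier_vec K \<Longrightarrow> f \<gamma> = (\<Sum>x\<in>X. c x * (\<Prod>k<K. (\<gamma> $ k) ^ e x k))"
  shows "mpoly_fun K f"
  unfolding mpoly_fun_def
proof (intro exI conjI ballI)
  show "finite (e ` X)" using X by simp
  fix \<gamma> :: "'a vec" assume g: "\<gamma> \<in> carrier_vec K"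
  have "f \<gamma> = (\<Sum>\<alpha>\<in>e ` X. \<Sum>x\<in>{x\<in>X. e x = \<alpha>}. c x * (\<Prod>k<K. (\<gamma> $ k) ^ e x k))"
    unfolding f[OF g] by (rule sum.image_gen[OF X])
  also have "\<dots> = (\<Sum>\<alpha>\<in>e ` X. (\<Sum>x\<in>{x\<in>X. e x = \<alpha>}. c x) * (\<Prod>k<K. (\<gamma> $ k) ^ \<alpha> k))"
    by (intro sum.cong refl) (simp add: sum_distrib_right)
  finally show "f \<gamma> = (\<Sum>\<alpha>\<in>e ` X. (\<Sum>x\<in>{x\<in>X. e x = \<alpha>}. c x) * (\<Prod>k<K. (\<gamma> $ k) ^ \<alpha> k))" .
qed

lemma mpoly_fun_const: "mpoly_fun K (\<lambda>_. c)"
  by (rule mpoly_fun_indexed[of "{()}" _ _ "\<lambda>_. c" "\<lambda>_ _. 0"]) simp_all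

lemma mpoly_fun_lin_form:
  fixes lam :: "'a::comm_ring_1 vec"
  shows "mpoly_fun K (lin_form K lam)"
proof (rule mpoly_fun_indexed[of "{..<K}" _ _ "\<lambda>l. lam $ l" "\<lambda>l k. of_bool (k = l)"])
  fix \<gamma> :: "'a vec"
  have "(\<Prod>k<K. (\<gamma> $ k) ^ of_bool (k = l)) = \<gamma> $ l" if "l < K" for l
    using that by (subst prod.remove[of _ l]) (auto intro!: prod.neutral)
  then show "lin_form K lam \<gamma> = (\<Sum>l<K. lam $ l * (\<Prod>k<K. (\<gamma> $ k) ^ of_bool (k = l)))"
    by (simp add: lin_form_def)
qed simp

lemma mpoly_fun_mult:
  fixes f g :: "'a::comm_ring_1 vec \<Rightarrow> 'a"
  assumes "mpoly_fun K f" "mpoly_fun K g"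
  shows "mpoly_fun K (\<lambda>\<gamma>. f \<gamma> * g \<gamma>)"
proof -
  obtain S c where S: "finite S"
    and f: "\<And>\<gamma>. \<gamma> \<in> carrier_vec K \<Longrightarrow> f \<gamma> = (\<Sum>\<alpha>\<in>S. c \<alpha> * (\<Prod>k<K. (\<gamma> $ k) ^ \<alpha> k))"
    using assms(1) unfolding mpoly_fun_def by blast
  obtain S' c' where S': "finite S'"
    and g: "\<And>\<gamma>. \<gamma> \<in> carrier_vec K \<Longrightarrow> g \<gamma> = (\<Sum>\<alpha>\<in>S'. c' \<alpha> * (\<Prod>k<K. (\<gamma> $ k) ^ \<alpha> k))"
    using assms(2) unfolding mpoly_fun_def by blast
  show ?thesis
  proof (rule mpoly_fun_indexed[where X = "S \<times> S'" and c = "\<lambda>x. c (fst x) * c' (snd x)"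
        and e = "\<lambda>x k. fst x k + snd x k"])
    fix \<gamma> :: "'a vec" assume "\<gamma> \<in> carrier_vec K"
    then have "f \<gamma> * g \<gamma> = (\<Sum>x\<in>S \<times> S'. (c (fst x) * (\<Prod>k<K. (\<gamma> $ k) ^ fst x k)) *
        (c' (snd x) * (\<Prod>k<K. (\<gamma> $ k) ^ snd x k)))"
      by (simp add: f g sum_product sum.cartesian_product split_def)
    then show "f \<gamma> * g \<gamma> = (\<Sum>x\<in>S \<times> S'. c (fst x) * c' (snd x) *
        (\<Prod>k<K. (\<gamma> $ k) ^ (fst x k + snd x k)))"
      by (simp add: power_add prod.distrib mult_ac)
  qed (use S S' in simp)
qed

lemma mpoly_fun_prod:
  fixes f :: "'i \<Rightarrow> 'a::comm_ring_1 vec \<Rightarrow> 'a"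
  assumes "finite X" "\<And>i. i \<in> X \<Longrightarrow> mpoly_fun K (f i)"
  shows "mpoly_fun K (\<lambda>\<gamma>. \<Prod>i\<in>X. f i \<gamma>)"
  using assms by (induction X) (auto intro: mpoly_fun_const mpoly_fun_mult)

lemma mpoly_fun_on_line:
  fixes f :: "'a::comm_ring_1 vec \<Rightarrow> 'a"
  assumes "mpoly_fun K f" and "\<gamma> \<in> carrier_vec K" "m \<in> carrier_vec K"
  obtains Q where "\<And>t. f (\<gamma> + t \<cdot>\<^sub>v m) = poly Q t"
proof -
  obtain S c where f: "\<And>\<gamma>. \<gamma> \<in> carrier_vec K \<Longrightarrow> f \<gamma> = (\<Sum>\<alpha>\<in>S. c \<alpha> * (\<Prod>k<K. (\<gamma> $ k) ^ \<alpha> k))"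
    using assms(1) unfolding mpoly_fun_def by blast
  have "f (\<gamma> + t \<cdot>\<^sub>v m) = poly (\<Sum>\<alpha>\<in>S. [:c \<alpha>:] * (\<Prod>k<K. [:\<gamma> $ k, m $ k:] ^ \<alpha> k)) t" for t
    using assms(2,3) by (simp add: f poly_sum poly_prod)
  then show thesis by (rule that)
qed

lemma lin_form_on_line:
  fixes lam :: "'a::comm_ring_1 vec"
  assumes "\<gamma> \<in> carrier_vec K" "m \<in> carrier_vec K"
  shows "lin_form K lam (\<gamma> + t \<cdot>\<^sub>v m) = poly [:lin_form K lam \<gamma>, lin_form K lam m:] t"
  using assms by (simp add: lin_form_def sum_distrib_left sum.distrib algebra_simps)

lemma det_pencil_eq_poly:
  fixes A B :: "'a::comm_ring_1 mat"
  assumes A: "A \<in> carrier_mat n n" and B: "B \<in> carrier_mat n n"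
  obtains P where "degree P \<le> n" "\<And>t. det (A + t \<cdot>\<^sub>m B) = poly P t"
proof -
  let ?q = "\<lambda>p. \<Prod>i<n. [:A $$ (i, p i), B $$ (i, p i):]"
  let ?P = "\<Sum>p\<in>{p. p permutes {..<n}}. smult (signof p) (?q p)"
  have "degree (?q p) \<le> n" for p
  proof -
    have "degree (?q p) \<le> (\<Sum>i<n. degree [:A $$ (i, p i), B $$ (i, p i):])"
      using degree_prod_sum_le[of "{..<n}" "\<lambda>i. [:A $$ (i, p i), B $$ (i, p i):]"]
      by (simp add: o_def)
    also have "\<dots> \<le> (\<Sum>i<n. 1)" by (intro sum_mono) simp
    finally show ?thesis by simp
  qed
  then have "degree ?P \<le> n"
    by (intro degree_sum_le finite_permutations) (auto intro: order_trans[OF degree_smult_le])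
  moreover have "det (A + t \<cdot>\<^sub>m B) = poly ?P t" for t
  proof -
    have "det (A + t \<cdot>\<^sub>m B)
        = (\<Sum>p\<in>{p. p permutes {..<n}}. signof p * (\<Prod>i<n. (A + t \<cdot>\<^sub>m B) $$ (i, p i)))"
      using det_def'[of "A + t \<cdot>\<^sub>m B" n] A B by (simp add: lessThan_atLeast0)
    also have "\<dots> = (\<Sum>p\<in>{p. p permutes {..<n}}. signof p * poly (?q p) t)"
    proof (intro sum.cong refl)
      fix p assume "p \<in> {p. p permutes {..<n}}"
      then have "p i < n" if "i < n" for i using that permutes_in_image[of p "{..<n}" i] by auto
      then have "(\<Prod>i<n. (A + t \<cdot>\<^sub>m B) $$ (i, p i)) = poly (?q p) t"
        using A B by (simp add: poly_prod)
      then show "signof p * (\<Prod>i<n. (A + t \<cdot>\<^sub>m B) $$ (i, p i)) = signof p * poly (?q p) t" by simp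
    qed
    finally show ?thesis by (simp add: poly_sum)
  qed
  ultimately show thesis by (rule that)
qed

lemma char_poly_fun_on_line:
  fixes T :: "'a::comm_ring_1 tensor3"
  assumes "\<gamma> \<in> carrier_vec K" "m \<in> carrier_vec K"
  obtains P where "degree P \<le> R" "\<And>t. char_poly_fun R K T (\<gamma> + t \<cdot>\<^sub>v m) = poly P t"
proof -
  have "slice_comb R K T (\<gamma> + t \<cdot>\<^sub>v m) = slice_comb R K T \<gamma> + t \<cdot>\<^sub>m slice_comb R K T m" for t
    using assms by (auto simp: slice_comb_def sum_distrib_left sum.distrib algebra_simps)
  moreover obtain P where "degree P \<le> R"
    "\<And>t. det (slice_comb R K T \<gamma> + t \<cdot>\<^sub>m slice_comb R K T m) = poly P t"
    using det_pencil_eq_poly[OF slice_comb_carrier slice_comb_carrier] by blast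
  ultimately show thesis using that[of P] by (simp add: char_poly_fun_def)
qed

lemma lin_pow_dvd_char_imp_le_order:
  fixes T :: "'a::field_char_0 tensor3"
  assumes dvd: "lin_pow_dvd_char R K T lam n" and line: "\<gamma> \<in> carrier_vec K" "m \<in> carrier_vec K"
    and P: "\<And>t. char_poly_fun R K T (\<gamma> + t \<cdot>\<^sub>v m) = poly P t" "P \<noteq> 0"
    and m: "lin_form K lam m \<noteq> 0"
  shows "n \<le> order (- (lin_form K lam \<gamma> / lin_form K lam m)) P"
proof -
  let ?a = "lin_form K lam \<gamma>" and ?b = "lin_form K lam m"
  obtain q where q: "mpoly_fun K q"
    and eq: "\<And>\<gamma>. \<gamma> \<in> carrier_vec K \<Longrightarrow> char_poly_fun R K T \<gamma> = lin_form K lam \<gamma> ^ n * q \<gamma>"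
    using dvd unfolding lin_pow_dvd_char_def by blast
  obtain Q where Q: "\<And>t. q (\<gamma> + t \<cdot>\<^sub>v m) = poly Q t" using mpoly_fun_on_line[OF q line] by blast
  have "poly P t = poly ([:?a, ?b:] ^ n * Q) t" for t
    using eq[of "\<gamma> + t \<cdot>\<^sub>v m"] line P(1)[of t] Q[of t] by (simp add: lin_form_on_line)
  then have "P = [:?a, ?b:] ^ n * Q" by (simp add: poly_eq_poly_eq_iff[symmetric] ext)
  also have "[:?a, ?b:] = smult ?b [:?a / ?b, 1:]" using m by simp
  finally have "P = smult (?b ^ n) ([:?a / ?b, 1:] ^ n * Q)"
    by (simp only: smult_power mult_smult_left)
  then have "[:?a / ?b, 1:] ^ n dvd P" by (simp only: dvd_smult dvd_triv_left)
  then show ?thesis using P(2) order_divides[of "- (?a / ?b)" n P] by simp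
qed

lemma lin_pow_dvd_char_le:
  fixes T :: "'a::field_char_0 tensor3"
  assumes \<gamma>: "\<gamma> \<in> carrier_vec K" "char_poly_fun R K T \<gamma> \<noteq> 0"
    and lam: "lam \<in> carrier_vec K" "lam \<noteq> 0\<^sub>v K" and dvd: "lin_pow_dvd_char R K T lam n"
  shows "n \<le> R"
proof -
  obtain k where k: "k < K" "lam $ k \<noteq> 0" using lam by (auto simp: vec_eq_iff)
  obtain P where P: "degree P \<le> R" "\<And>t. char_poly_fun R K T (\<gamma> + t \<cdot>\<^sub>v unit_vec K k) = poly P t"
    using char_poly_fun_on_line[OF \<gamma>(1) unit_vec_carrier] by blast
  have "\<gamma> + 0 \<cdot>\<^sub>v unit_vec K k = \<gamma>" using \<gamma>(1) by auto
  then have "P \<noteq> 0" using P(2)[of 0] \<gamma>(2) by auto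
  then have "n \<le> order (- (lin_form K lam \<gamma> / lin_form K lam (unit_vec K k))) P"
    using lin_pow_dvd_char_imp_le_order[OF dvd \<gamma>(1) unit_vec_carrier P(2)] k
    by (simp add: lin_form_unit_vec)
  also have "\<dots> \<le> degree P" using \<open>P \<noteq> 0\<close> by (rule order_degree)
  finally show ?thesis using P(1) by simp
qed

lemma lin_pow_dvd_char_smult:
  fixes T :: "'a::comm_ring_1 tensor3"
  assumes "lin_pow_dvd_char R K T (c \<cdot>\<^sub>v lam) n" "lam \<in> carrier_vec K"
  shows "lin_pow_dvd_char R K T lam n"
proof -
  obtain q where "mpoly_fun K q"
    and "\<And>\<gamma>. \<gamma> \<in> carrier_vec K \<Longrightarrow> char_poly_fun R K T \<gamma> = lin_form K (c \<cdot>\<^sub>v lam) \<gamma> ^ n * q \<gamma>"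
    using assms(1) unfolding lin_pow_dvd_char_def by blast
  then have "mpoly_fun K (\<lambda>\<gamma>. c ^ n * q \<gamma>) \<and>
      (\<forall>\<gamma>\<in>carrier_vec K. char_poly_fun R K T \<gamma> = lin_form K lam \<gamma> ^ n * (c ^ n * q \<gamma>))"
    using assms(2)
    by (simp add: mpoly_fun_mult mpoly_fun_const lin_form_smult power_mult_distrib mult_ac)
  then show ?thesis unfolding lin_pow_dvd_char_def by blast
qed

lemma
  fixes T :: "'a::field_char_0 tensor3"
  assumes \<gamma>: "\<gamma> \<in> carrier_vec K" "char_poly_fun R K T \<gamma> \<noteq> 0"
    and lam: "lam \<in> carrier_vec K" "lam \<noteq> 0\<^sub>v K" and dvd: "lin_pow_dvd_char R K T lam n"
  shows le_jge_am: "n \<le> jge_am R K T (vspan K {lam})"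
    and lin_pow_dvd_char_jge_am: "lin_pow_dvd_char R K T lam (jge_am R K T (vspan K {lam}))"
proof -
  let ?D = "\<lambda>n. \<exists>mu. mu \<in> carrier_vec K \<and> mu \<noteq> 0\<^sub>v K \<and> vspan K {lam} = vspan K {mu} \<and>
    lin_pow_dvd_char R K T mu n"
  have D: "?D n" using lam dvd by blast
  have bound: "n' \<le> R" if "?D n'" for n' using that lin_pow_dvd_char_le[OF \<gamma>] by blast
  show "n \<le> jge_am R K T (vspan K {lam})"
    unfolding jge_am_def by (rule Greatest_le_nat[of ?D, OF D bound])
  have "?D (jge_am R K T (vspan K {lam}))"
    unfolding jge_am_def by (rule GreatestI_nat[of ?D, OF D bound])
  then obtain mu where mu: "mu \<in> carrier_vec K" "mu \<noteq> 0\<^sub>v K" "vspan K {mu} = vspan K {lam}"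
    and dvd_mu: "lin_pow_dvd_char R K T mu (jge_am R K T (vspan K {lam}))"
    by auto
  obtain c where "mu = c \<cdot>\<^sub>v lam" using vspan_singleton_eq_iff[OF lam(1) mu(1,2)] mu(3) by blast
  then show "lin_pow_dvd_char R K T lam (jge_am R K T (vspan K {lam}))"
    using lin_pow_dvd_char_smult dvd_mu lam(1) by blast
qed

definition char_poly_splits ::
  "nat \<Rightarrow> nat \<Rightarrow> 'a::comm_ring_1 tensor3 \<Rightarrow> 'a \<Rightarrow> (nat \<Rightarrow> 'a vec) \<Rightarrow> bool" where
  "char_poly_splits R K T d l \<longleftrightarrow> (\<forall>r<R. l r \<in> carrier_vec K) \<and>
     (\<forall>\<gamma>\<in>carrier_vec K. char_poly_fun R K T \<gamma> = d * (\<Prod>r<R. lin_form K (l r) \<gamma>))"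

lemma char_poly_splits_on_line:
  fixes T :: "'a::comm_ring_1 tensor3"
  assumes "char_poly_splits R K T d l" "\<gamma> \<in> carrier_vec K" "m \<in> carrier_vec K"
  shows "char_poly_fun R K T (\<gamma> + t \<cdot>\<^sub>v m)
    = poly (smult d (\<Prod>r<R. [:lin_form K (l r) \<gamma>, lin_form K (l r) m:])) t"
  using assms by (simp add: char_poly_splits_def lin_form_on_line poly_prod)

lemma char_poly_splits_imp_lin_pow_dvd_char:
  fixes T :: "'a::field tensor3"
  assumes splits: "char_poly_splits R K T d l" and nz: "\<And>s. s < R \<Longrightarrow> l s \<noteq> 0\<^sub>v K" and r: "r < R"
  shows "lin_pow_dvd_char R K T (l r) (card {s. s < R \<and> vspan K {l s} = vspan K {l r}})"
proof -
  let ?C = "{s. s < R \<and> vspan K {l s} = vspan K {l r}}"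
  have l: "l s \<in> carrier_vec K" if "s < R" for s
    using splits that by (simp add: char_poly_splits_def)
  have "\<forall>s\<in>?C. \<exists>c. l s = c \<cdot>\<^sub>v l r"
    using vspan_singleton_eq_iff[OF l[OF r] l nz] by blast
  from bchoice[OF this] obtain c where c: "\<forall>s\<in>?C. l s = c s \<cdot>\<^sub>v l r" ..
  let ?q = "\<lambda>\<gamma>. d * (\<Prod>s\<in>?C. c s) * (\<Prod>s\<in>{..<R} - ?C. lin_form K (l s) \<gamma>)"
  have "mpoly_fun K ?q"
    by (intro mpoly_fun_mult mpoly_fun_const mpoly_fun_prod mpoly_fun_lin_form) simp
  moreover have "char_poly_fun R K T \<gamma> = lin_form K (l r) \<gamma> ^ card ?C * ?q \<gamma>"
    if "\<gamma> \<in> carrier_vec K" for \<gamma>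
  proof -
    have "(\<Prod>s<R. lin_form K (l s) \<gamma>)
        = (\<Prod>s\<in>{..<R} - ?C. lin_form K (l s) \<gamma>) * (\<Prod>s\<in>?C. lin_form K (l s) \<gamma>)"
      by (rule prod.subset_diff) auto
    also have "(\<Prod>s\<in>?C. lin_form K (l s) \<gamma>) = (\<Prod>s\<in>?C. c s * lin_form K (l r) \<gamma>)"
    proof (intro prod.cong refl)
      fix s assume "s \<in> ?C"
      then have "l s = c s \<cdot>\<^sub>v l r" using c by blast
      then show "lin_form K (l s) \<gamma> = c s * lin_form K (l r) \<gamma>"
        using lin_form_smult[OF l[OF r]] by metis
    qed
    finally show ?thesis
      using splits that by (simp add: char_poly_splits_def prod.distrib mult_ac)
  qed
  ultimately show ?thesis unfolding lin_pow_dvd_char_def by blast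
qed

lemma obtain_vec_avoiding_hyperplanes:
  fixes W :: "'a::field_char_0 vec set"
  assumes "finite W" and W: "\<And>w. w \<in> W \<Longrightarrow> w \<in> carrier_vec K \<and> w \<noteq> 0\<^sub>v K"
  obtains m where "m \<in> carrier_vec K" "\<And>w. w \<in> W \<Longrightarrow> lin_form K w m \<noteq> 0"
proof -
  define p where "p w = (\<Sum>k<K. monom (w $ k) k)" for w :: "'a vec"
  have "p w \<noteq> 0" if "w \<in> W" for w
  proof -
    obtain k where "k < K" "w $ k \<noteq> 0" using W[OF \<open>w \<in> W\<close>] by (auto simp: vec_eq_iff)
    then have "coeff (p w) k \<noteq> 0" by (simp add: p_def coeff_sum)
    then show ?thesis by auto
  qed
  then have "(\<Prod>w\<in>W. p w) \<noteq> 0" using \<open>finite W\<close> by simp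
  then obtain t where "poly (\<Prod>w\<in>W. p w) t \<noteq> 0"
    using poly_all_0_iff_0 by blast
  then have "poly (p w) t \<noteq> 0" if "w \<in> W" for w using that \<open>finite W\<close> by (auto simp: poly_prod)
  then have "lin_form K w (vec K (\<lambda>k. t ^ k)) \<noteq> 0" if "w \<in> W" for w
    using that by (force simp: p_def lin_form_def poly_sum poly_monom)
  then show thesis by (rule that[OF vec_carrier])
qed

lemma order_prod_linear_le_1:
  fixes a b :: "'i \<Rightarrow> 'a::idom"
  assumes "finite X" and a: "\<And>i. i \<in> X \<Longrightarrow> a i \<noteq> 0"
    and ab: "\<And>i j. i \<in> X \<Longrightarrow> j \<in> X \<Longrightarrow> i \<noteq> j \<Longrightarrow> a i * b j \<noteq> a j * b i"
  shows "order t (\<Prod>i\<in>X. [:a i, b i:]) \<le> 1"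
proof (cases "poly (\<Prod>i\<in>X. [:a i, b i:]) t = 0")
  case True
  then obtain i where i: "i \<in> X" "a i = - (t * b i)"
    using \<open>finite X\<close> by (auto simp: poly_prod eq_neg_iff_add_eq_0)
  have "a j + t * b j \<noteq> 0" if "j \<in> X - {i}" for j
    using ab[of i j] i that by (auto simp: add_eq_0_iff2 mult_ac)
  then have rest: "poly (\<Prod>j\<in>X - {i}. [:a j, b j:]) t \<noteq> 0"
    using \<open>finite X\<close> by (simp add: poly_prod)
  have nz: "[:a i, b i:] \<noteq> 0" using a[OF i(1)] by simp
  have "order t (\<Prod>i\<in>X. [:a i, b i:]) = order t [:a i, b i:] + order t (\<Prod>j\<in>X - {i}. [:a j, b j:])"
    unfolding prod.remove[OF \<open>finite X\<close> i(1)]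
  proof (rule order_mult)
    have "(\<Prod>j\<in>X - {i}. [:a j, b j:]) \<noteq> 0" using rest by (metis poly_0)
    with nz show "[:a i, b i:] * (\<Prod>j\<in>X - {i}. [:a j, b j:]) \<noteq> 0" by (rule no_zero_divisors)
  qed
  also have "\<dots> \<le> 1"
    using order_degree[OF nz, of t] order_0I[OF rest] by (simp split: if_splits)
  finally show ?thesis .
qed (simp add: order_0I)

text \<open>On a generic line through a point where none of them vanishes, pairwise non-proportional
  linear forms have distinct roots.\<close>

lemma obtain_generic_direction:
  fixes l :: "nat \<Rightarrow> 'a::field_char_0 vec"
  assumes l: "\<And>r. r < R \<Longrightarrow> l r \<in> carrier_vec K" "\<And>r. r < R \<Longrightarrow> lin_form K (l r) \<gamma> \<noteq> 0"
    and nonprop: "\<forall>r<R. \<forall>s<R. r \<noteq> s \<longrightarrow> \<not> (\<exists>c. l r = c \<cdot>\<^sub>v l s)"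
    and lam: "lam \<in> carrier_vec K" "lam \<noteq> 0\<^sub>v K"
  obtains m where "m \<in> carrier_vec K" "lin_form K lam m \<noteq> 0"
    "\<And>i j. i < R \<Longrightarrow> j < R \<Longrightarrow> i \<noteq> j \<Longrightarrow>
      lin_form K (l i) \<gamma> * lin_form K (l j) m \<noteq> lin_form K (l j) \<gamma> * lin_form K (l i) m"
proof -
  define \<alpha> where "\<alpha> r = lin_form K (l r) \<gamma>" for r
  define w where "w i j = \<alpha> i \<cdot>\<^sub>v l j - \<alpha> j \<cdot>\<^sub>v l i" for i j
  have w: "w i j \<in> carrier_vec K" "w i j \<noteq> 0\<^sub>v K" if ij: "i < R" "j < R" "i \<noteq> j" for i j
  proof -
    show "w i j \<in> carrier_vec K" using l(1) ij by (simp add: w_def)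
    show "w i j \<noteq> 0\<^sub>v K"
    proof
      assume zero: "w i j = 0\<^sub>v K"
      have "l i $ k = \<alpha> i / \<alpha> j * l j $ k" if "k < K" for k
        using arg_cong[OF zero, of "\<lambda>v. v $ k"] that l(1)[OF ij(1)] l(1)[OF ij(2)] l(2)[OF ij(2)]
        by (simp add: w_def \<alpha>_def field_simps)
      then have "l i = (\<alpha> i / \<alpha> j) \<cdot>\<^sub>v l j"
        using l(1)[OF ij(1)] l(1)[OF ij(2)] by (intro eq_vecI) auto
      then show False using nonprop ij by blast
    qed
  qed
  let ?W = "insert lam ((\<lambda>(i, j). w i j) ` ({..<R} \<times> {..<R} - Id))"
  have "v \<in> carrier_vec K \<and> v \<noteq> 0\<^sub>v K" if "v \<in> ?W" for v using that lam w by auto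
  then obtain m where m: "m \<in> carrier_vec K" "\<And>v. v \<in> ?W \<Longrightarrow> lin_form K v m \<noteq> 0"
    using obtain_vec_avoiding_hyperplanes[of ?W K] by auto
  have "\<alpha> i * lin_form K (l j) m \<noteq> \<alpha> j * lin_form K (l i) m" if "i < R" "j < R" "i \<noteq> j" for i j
  proof -
    have "w i j \<in> ?W" using that by (intro insertI2 image_eqI[of _ _ "(i, j)"]) auto
    then have "lin_form K (w i j) m \<noteq> 0" by (rule m(2))
    then show ?thesis using l(1) that by (simp add: w_def lin_form_minus lin_form_smult)
  qed
  then show thesis using that m unfolding \<alpha>_def by blast
qed

lemma simple_tensor_no_square_factor:
  fixes T :: "'a::field_char_0 tensor3"
  assumes simple: "simple_tensor R K T" and lam: "lam \<in> carrier_vec K" "lam \<noteq> 0\<^sub>v K"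
    and dvd: "lin_pow_dvd_char R K T lam n"
  shows "n \<le> 1"
proof -
  obtain l where splits: "char_poly_splits R K T 1 l"
    and nonprop: "\<forall>r<R. \<forall>s<R. r \<noteq> s \<longrightarrow> \<not> (\<exists>c. l r = c \<cdot>\<^sub>v l s)"
    using simple unfolding simple_tensor_def char_poly_splits_def mult_1 by blast
  obtain \<gamma> where \<gamma>: "\<gamma> \<in> carrier_vec K" "char_poly_fun R K T \<gamma> \<noteq> 0"
    using simple unfolding simple_tensor_def slice_mix_invertible_iff by blast
  have l: "l r \<in> carrier_vec K" "lin_form K (l r) \<gamma> \<noteq> 0" if "r < R" for r
    using splits \<gamma> that by (auto simp: char_poly_splits_def)
  obtain m where m: "m \<in> carrier_vec K" "lin_form K lam m \<noteq> 0"
    and generic: "\<And>i j. i < R \<Longrightarrow> j < R \<Longrightarrow> i \<noteq> j \<Longrightarrow>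
      lin_form K (l i) \<gamma> * lin_form K (l j) m \<noteq> lin_form K (l j) \<gamma> * lin_form K (l i) m"
    using obtain_generic_direction[OF l nonprop lam] by blast
  let ?P = "\<Prod>r<R. [:lin_form K (l r) \<gamma>, lin_form K (l r) m:]"
  have "n \<le> order (- (lin_form K lam \<gamma> / lin_form K lam m)) ?P"
    using l(2) m lin_pow_dvd_char_imp_le_order[OF dvd \<gamma>(1) m(1)]
      char_poly_splits_on_line[OF splits \<gamma>(1) m(1)]
    by simp
  also have "\<dots> \<le> 1" using l(2) generic by (intro order_prod_linear_le_1) auto
  finally show ?thesis .
qed

section \<open>Limits of tensors\<close>

lemma tendsto_det:
  fixes A :: "'a::real_normed_field mat"
  assumes M: "\<And>m. M m \<in> carrier_mat n n" and A: "A \<in> carrier_mat n n"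
    and lim: "\<And>i j. i < n \<Longrightarrow> j < n \<Longrightarrow> ((\<lambda>m. M m $$ (i, j)) \<longlongrightarrow> A $$ (i, j)) F"
  shows "((\<lambda>m. det (M m)) \<longlongrightarrow> det A) F"
  unfolding det_def'[OF M] det_def'[OF A]
  using permutes_in_image[of _ "{0..<n}"] by (intro tendsto_intros lim) auto

lemma tendsto_slice_comb:
  fixes S :: "'b \<Rightarrow> 'a::real_normed_field tensor3"
  assumes "\<And>i j k. i < R \<Longrightarrow> j < R \<Longrightarrow> k < K \<Longrightarrow> ((\<lambda>n. S n i j k) \<longlongrightarrow> T i j k) F"
    and "i < R" "j < R"
  shows "((\<lambda>n. slice_comb R K (S n) \<gamma> $$ (i, j)) \<longlongrightarrow> slice_comb R K T \<gamma> $$ (i, j)) F"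
  using assms by (auto simp: slice_comb_def intro!: tendsto_intros)

lemma tendsto_char_poly_fun:
  fixes S :: "'b \<Rightarrow> 'a::real_normed_field tensor3"
  assumes "\<And>i j k. i < R \<Longrightarrow> j < R \<Longrightarrow> k < K \<Longrightarrow> ((\<lambda>n. S n i j k) \<longlongrightarrow> T i j k) F"
  shows "((\<lambda>n. char_poly_fun R K (S n) \<gamma>) \<longlongrightarrow> char_poly_fun R K T \<gamma>) F"
  unfolding char_poly_fun_def
  by (intro tendsto_det[OF slice_comb_carrier slice_comb_carrier] tendsto_slice_comb assms)

lemma tendsto_lin_form:
  fixes v :: "'b \<Rightarrow> 'a::real_normed_field vec"
  assumes "\<And>k. k < K \<Longrightarrow> ((\<lambda>n. v n $ k) \<longlongrightarrow> w $ k) F"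
  shows "((\<lambda>n. lin_form K (v n) \<gamma>) \<longlongrightarrow> lin_form K w \<gamma>) F"
  unfolding lin_form_def using assms by (auto intro!: tendsto_intros)

lemma tendsto_mult_mat_vec:
  fixes A :: "'a::real_normed_field mat"
  assumes M: "\<And>m. M m \<in> carrier_mat n p" and A: "A \<in> carrier_mat n p"
    and v: "\<And>m. v m \<in> carrier_vec p" and w: "w \<in> carrier_vec p"
    and "\<And>j. j < p \<Longrightarrow> ((\<lambda>m. M m $$ (i, j)) \<longlongrightarrow> A $$ (i, j)) F"
    and "\<And>j. j < p \<Longrightarrow> ((\<lambda>m. v m $ j) \<longlongrightarrow> w $ j) F" and i: "i < n"
  shows "((\<lambda>m. (M m *\<^sub>v v m) $ i) \<longlongrightarrow> (A *\<^sub>v w) $ i) F"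
  unfolding index_mult_mat_vec_sum[OF M v i] index_mult_mat_vec_sum[OF A w i]
  using assms by (auto intro!: tendsto_intros)

definition vec_norm1 :: "'a::real_normed_vector vec \<Rightarrow> real" where
  "vec_norm1 v = (\<Sum>i<dim_vec v. norm (v $ i))"

lemma norm_index_le_vec_norm1: "i < dim_vec v \<Longrightarrow> norm (v $ i) \<le> vec_norm1 v"
  unfolding vec_norm1_def by (rule member_le_sum) auto

lemma vec_norm1_zero_vec: "vec_norm1 (0\<^sub>v n) = 0"
  by (simp add: vec_norm1_def)

lemma normalize_vec_norm1:
  fixes v :: "'a::real_normed_field vec"
  assumes v: "v \<in> carrier_vec n" "v \<noteq> 0\<^sub>v n"
  obtains c where "c \<noteq> 0" "vec_norm1 (c \<cdot>\<^sub>v v) = 1"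
proof -
  obtain i where "i < dim_vec v" "v $ i \<noteq> 0" using v by (auto simp: vec_eq_iff)
  then have pos: "vec_norm1 v > 0" using norm_index_le_vec_norm1[of i v]
    by (metis less_le_trans zero_less_norm_iff)
  have "vec_norm1 (c \<cdot>\<^sub>v v) = norm c * vec_norm1 v" for c
    by (simp add: vec_norm1_def norm_mult sum_distrib_left)
  then show thesis using pos that[of "inverse (of_real (vec_norm1 v))"] by (simp add: norm_inverse)
qed

lemma (in normed_conjugation) normalized_vecs_convergent_subseq:
  fixes v :: "nat \<Rightarrow> 'i \<Rightarrow> 'a vec" and m :: "'i \<Rightarrow> nat"
  assumes X: "finite X" and v: "\<And>n i. i \<in> X \<Longrightarrow> v n i \<in> carrier_vec (m i) \<and> vec_norm1 (v n i) = 1"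
  obtains s w where "strict_mono (s :: nat \<Rightarrow> nat)"
    "\<And>i. i \<in> X \<Longrightarrow> w i \<in> carrier_vec (m i) \<and> w i \<noteq> 0\<^sub>v (m i)"
    "\<And>i k. i \<in> X \<Longrightarrow> k < m i \<Longrightarrow> (\<lambda>n. v (s n) i $ k) \<longlonglongrightarrow> w i $ k"
proof -
  have bounded: "norm (v n (fst p) $ snd p) \<le> 1" if "p \<in> (SIGMA i:X. {..<m i})" for p n
    using that v[of "fst p" n] norm_index_le_vec_norm1[of "snd p" "v n (fst p)"] by auto
  obtain s where s: "strict_mono (s :: nat \<Rightarrow> nat)"
    and conv: "\<And>p. p \<in> (SIGMA i:X. {..<m i}) \<Longrightarrow> convergent (\<lambda>n. v (s n) (fst p) $ snd p)"
    using bounded_family_obtain_convergent_subseq[of "SIGMA i:X. {..<m i}"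
        "\<lambda>p n. v n (fst p) $ snd p" 1]
      bounded X by blast
  define w where "w i = vec (m i) (\<lambda>k. lim (\<lambda>n. v (s n) i $ k))" for i
  have lim: "(\<lambda>n. v (s n) i $ k) \<longlonglongrightarrow> w i $ k" if "i \<in> X" "k < m i" for i k
    using conv[of "(i, k)"] that by (simp add: w_def convergent_LIMSEQ_iff)
  have "w i \<noteq> 0\<^sub>v (m i)" if i: "i \<in> X" for i
  proof
    assume "w i = 0\<^sub>v (m i)"
    then have "(\<lambda>n. \<Sum>k<m i. norm (v (s n) i $ k)) \<longlonglongrightarrow> (\<Sum>k<m i. norm (0::'a))"
      using lim[OF i] by (intro tendsto_sum tendsto_norm) auto
    moreover have "(\<Sum>k<m i. norm (v (s n) i $ k)) = 1" for n
      using v[OF i, of "s n"] by (auto simp: vec_norm1_def)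
    ultimately show False by (simp add: LIMSEQ_const_iff)
  qed
  then show thesis using that[of s w] s lim by (simp add: w_def)
qed

lemma jge_pair_smult:
  fixes T :: "'a::field tensor3"
  assumes "jge_pair R K T L x" "c \<noteq> 0"
  shows "jge_pair R K T L (c \<cdot>\<^sub>v x)"
proof -
  obtain lam y where x: "x \<in> carrier_vec R" "x \<noteq> 0\<^sub>v R" and y: "y \<in> carrier_vec R" "y \<noteq> 0\<^sub>v R"
    and lam: "lam \<in> carrier_vec K" "L = vspan K {lam}"
    and eq: "\<And>l. l < K \<Longrightarrow> slice R T l *\<^sub>v x = lam $ l \<cdot>\<^sub>v y"
    using assms(1) by (rule jge_pairE) blast
  have "c \<cdot>\<^sub>v v \<noteq> 0\<^sub>v R" if "v \<in> carrier_vec R" "v \<noteq> 0\<^sub>v R" for v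
    using that assms(2) by (auto simp: vec_eq_iff)
  moreover have "slice R T l *\<^sub>v (c \<cdot>\<^sub>v x) = lam $ l \<cdot>\<^sub>v (c \<cdot>\<^sub>v y)" if "l < K" for l
    using eq[OF that] x(1) mult_mat_vec[OF slice_carrier x(1)]
    by (simp add: smult_smult_assoc mult.commute)
  ultimately show ?thesis
    unfolding lam(2) using x y lam(1) by (intro jge_pairI[where y = "c \<cdot>\<^sub>v y"]) auto
qed

lemma cpd_normalized_jge_pairs:
  fixes S :: "'a::real_normed_field tensor3"
  assumes cpd: "has_cpd R R K S R" and \<gamma>: "\<gamma> \<in> carrier_vec K" "char_poly_fun R K S \<gamma> \<noteq> 0"
  obtains d l x where "char_poly_splits R K S d l"
    "\<And>r. r < R \<Longrightarrow> vec_norm1 (l r) = 1 \<and> vec_norm1 (x r) = 1 \<and> jge_pair R K S (vspan K {l r}) (x r)"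
proof -
  obtain A B C where ABC: "A \<in> carrier_mat R R" "B \<in> carrier_mat R R" "C \<in> carrier_mat K R"
    and S: "S = cpd R R K R A B C" using cpd by (rule has_cpdE)
  note char = char_poly_fun_cpd[OF ABC, folded S]
  have det: "det A \<noteq> 0" "det B \<noteq> 0" and forms: "\<And>r. r < R \<Longrightarrow> lin_form K (col C r) \<gamma> \<noteq> 0"
    using \<gamma>(2) char[of \<gamma>] by auto
  have C: "col C r \<in> carrier_vec K" "col C r \<noteq> 0\<^sub>v K" if "r < R" for r
  proof -
    show "col C r \<in> carrier_vec K" using ABC(3) that by simp
    have "lin_form K (0\<^sub>v K) \<gamma> = 0" by (simp add: lin_form_def)
    then show "col C r \<noteq> 0\<^sub>v K" using forms[OF that] by metis
  qed
  obtain X where X: "X \<in> carrier_mat R R" "transpose_mat B * X = 1\<^sub>m R"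
    using det_nonzero_obtain_dual[OF ABC(2) det(2)] by blast
  have pair: "jge_pair R K S (vspan K {col C r}) (col X r)" if "r < R" for r
    using jge_pair_cpd[OF ABC det(1) X that] S by simp
  have "\<forall>r. \<exists>c. r < R \<longrightarrow> c \<noteq> 0 \<and> vec_norm1 (c \<cdot>\<^sub>v col C r) = 1" using C normalize_vec_norm1 by metis
  then obtain c where c: "\<And>r. r < R \<Longrightarrow> c r \<noteq> 0 \<and> vec_norm1 (c r \<cdot>\<^sub>v col C r) = 1" by metis
  have "\<forall>r. \<exists>e. r < R \<longrightarrow> e \<noteq> 0 \<and> vec_norm1 (e \<cdot>\<^sub>v col X r) = 1"
    using pair normalize_vec_norm1 unfolding jge_pair_def by metis
  then obtain e where e: "\<And>r. r < R \<Longrightarrow> e r \<noteq> 0 \<and> vec_norm1 (e r \<cdot>\<^sub>v col X r) = 1" by metis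
  show thesis
  proof
    have "(\<Prod>r<R. lin_form K (c r \<cdot>\<^sub>v col C r) \<gamma>)
        = (\<Prod>r<R. c r) * (\<Prod>r<R. lin_form K (col C r) \<gamma>)" for \<gamma>
      using C(1) by (simp add: lin_form_smult prod.distrib)
    moreover have "(\<Prod>r<R. c r) \<noteq> 0" using c by simp
    ultimately show "char_poly_splits R K S (det A * det B / (\<Prod>r<R. c r)) (\<lambda>r. c r \<cdot>\<^sub>v col C r)"
      using C(1) by (simp add: char_poly_splits_def char)
    fix r assume r: "r < R"
    have "c r \<cdot>\<^sub>v col C r \<noteq> 0\<^sub>v K" using c[OF r] vec_norm1_zero_vec[of K] by (metis zero_neq_one)
    then have "vspan K {c r \<cdot>\<^sub>v col C r} = vspan K {col C r}"
      using vspan_singleton_eq_iff[OF C(1)[OF r], of "c r \<cdot>\<^sub>v col C r"] C(1)[OF r] c[OF r] by auto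
    then show "vec_norm1 (c r \<cdot>\<^sub>v col C r) = 1 \<and> vec_norm1 (e r \<cdot>\<^sub>v col X r) = 1 \<and>
        jge_pair R K S (vspan K {c r \<cdot>\<^sub>v col C r}) (e r \<cdot>\<^sub>v col X r)"
      using c[OF r] e[OF r] jge_pair_smult[OF pair[OF r]] by simp
  qed
qed

lemma jge_pair_limit:
  fixes T :: "'a::real_normed_field tensor3"
  assumes lim: "\<And>i j k. i < R \<Longrightarrow> j < R \<Longrightarrow> k < K \<Longrightarrow> (\<lambda>n. S n i j k) \<longlonglongrightarrow> T i j k"
    and det: "\<And>n. char_poly_fun R K (S n) \<gamma> \<noteq> 0" "char_poly_fun R K T \<gamma> \<noteq> 0"
    and pair: "\<And>n. jge_pair R K (S n) (vspan K {lam n}) (x n)"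
    and lam: "\<And>n. lam n \<in> carrier_vec K" "\<And>k. k < K \<Longrightarrow> (\<lambda>n. lam n $ k) \<longlonglongrightarrow> lam' $ k"
      "lam' \<in> carrier_vec K" "lam' \<noteq> 0\<^sub>v K"
    and x: "\<And>j. j < R \<Longrightarrow> (\<lambda>n. x n $ j) \<longlonglongrightarrow> x' $ j" "x' \<in> carrier_vec R" "x' \<noteq> 0\<^sub>v R"
  shows "jge_pair R K T (vspan K {lam'}) x'"
proof -
  have rel: "x n \<in> carrier_vec R" "\<And>l. l < K \<Longrightarrow> lin_form K (lam n) \<gamma> \<cdot>\<^sub>v (slice R (S n) l *\<^sub>v x n)
      = lam n $ l \<cdot>\<^sub>v (slice_comb R K (S n) \<gamma> *\<^sub>v x n)" for n
    using pair[of n] jge_pair_iff_slice_comb[OF det(1) lam(1)] by blast+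
  have mix: "(\<lambda>n. (slice_comb R K (S n) \<delta> *\<^sub>v x n) $ i) \<longlonglongrightarrow> (slice_comb R K T \<delta> *\<^sub>v x') $ i"
    if "i < R" for i \<delta>
    using that x(2) rel(1)
    by (intro tendsto_mult_mat_vec[OF slice_comb_carrier slice_comb_carrier]
        tendsto_slice_comb lim x(1))
  have "lin_form K lam' \<gamma> \<cdot>\<^sub>v (slice R T l *\<^sub>v x') = lam' $ l \<cdot>\<^sub>v (slice_comb R K T \<gamma> *\<^sub>v x')"
    if l: "l < K" for l
  proof (rule eq_vecI)
    fix i assume "i < dim_vec (lam' $ l \<cdot>\<^sub>v (slice_comb R K T \<gamma> *\<^sub>v x'))"
    then have i: "i < R" by (simp add: slice_comb_def)
    have "(\<lambda>n. lin_form K (lam n) \<gamma> * (slice R (S n) l *\<^sub>v x n) $ i)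
        \<longlonglongrightarrow> lin_form K lam' \<gamma> * (slice R T l *\<^sub>v x') $ i"
      unfolding slice_eq_slice_comb[OF l] by (intro tendsto_mult tendsto_lin_form lam(2) mix i)
    moreover have "lin_form K (lam n) \<gamma> * (slice R (S n) l *\<^sub>v x n) $ i
        = lam n $ l * (slice_comb R K (S n) \<gamma> *\<^sub>v x n) $ i" for n
      using arg_cong[OF rel(2)[OF l, of n], of "\<lambda>v. v $ i"] i
      by (simp add: slice_def slice_comb_def)
    moreover have "(\<lambda>n. lam n $ l * (slice_comb R K (S n) \<gamma> *\<^sub>v x n) $ i)
        \<longlonglongrightarrow> lam' $ l * (slice_comb R K T \<gamma> *\<^sub>v x') $ i"
      by (intro tendsto_mult lam(2) mix i l)
    ultimately show "(lin_form K lam' \<gamma> \<cdot>\<^sub>v (slice R T l *\<^sub>v x')) $ i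
        = (lam' $ l \<cdot>\<^sub>v (slice_comb R K T \<gamma> *\<^sub>v x')) $ i"
      using LIMSEQ_unique i by (simp add: slice_def slice_comb_def) blast
  qed (simp add: slice_def slice_comb_def)
  then show ?thesis
    using jge_pair_iff_slice_comb[OF det(2) lam(3)] lam(4) x(2,3) by blast
qed

text \<open>The splitting is cross-multiplied with its value at \<open>\<gamma>\<close>, so that the constants \<open>d n\<close> need
  not converge.\<close>

lemma char_poly_splits_limit:
  fixes T :: "'a::real_normed_field tensor3"
  assumes lim: "\<And>i j k. i < R \<Longrightarrow> j < R \<Longrightarrow> k < K \<Longrightarrow> (\<lambda>n. S n i j k) \<longlonglongrightarrow> T i j k"
    and splits: "\<And>n. char_poly_splits R K (S n) (d n) (l n)"
    and l: "\<And>r k. r < R \<Longrightarrow> k < K \<Longrightarrow> (\<lambda>n. l n r $ k) \<longlonglongrightarrow> l' r $ k"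
      "\<And>r. r < R \<Longrightarrow> l' r \<in> carrier_vec K"
    and \<gamma>: "\<gamma> \<in> carrier_vec K" "\<And>r. r < R \<Longrightarrow> lin_form K (l' r) \<gamma> \<noteq> 0"
  shows "char_poly_splits R K T (char_poly_fun R K T \<gamma> / (\<Prod>r<R. lin_form K (l' r) \<gamma>)) l'"
proof -
  have prod_lim: "(\<lambda>n. \<Prod>r<R. lin_form K (l n r) \<delta>) \<longlonglongrightarrow> (\<Prod>r<R. lin_form K (l' r) \<delta>)" for \<delta>
    using l(1) by (intro tendsto_prod tendsto_lin_form) auto
  have "char_poly_fun R K T \<delta> * (\<Prod>r<R. lin_form K (l' r) \<gamma>)
      = char_poly_fun R K T \<gamma> * (\<Prod>r<R. lin_form K (l' r) \<delta>)" if \<delta>: "\<delta> \<in> carrier_vec K" for \<delta>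
  proof (rule LIMSEQ_unique)
    show "(\<lambda>n. char_poly_fun R K (S n) \<delta> * (\<Prod>r<R. lin_form K (l n r) \<gamma>))
        \<longlonglongrightarrow> char_poly_fun R K T \<delta> * (\<Prod>r<R. lin_form K (l' r) \<gamma>)"
      by (intro tendsto_mult tendsto_char_poly_fun lim prod_lim)
    have "char_poly_fun R K (S n) \<delta> * (\<Prod>r<R. lin_form K (l n r) \<gamma>)
        = char_poly_fun R K (S n) \<gamma> * (\<Prod>r<R. lin_form K (l n r) \<delta>)" for n
      using splits[of n] \<gamma>(1) \<delta> by (simp add: char_poly_splits_def)
    then show "(\<lambda>n. char_poly_fun R K (S n) \<delta> * (\<Prod>r<R. lin_form K (l n r) \<gamma>))
        \<longlonglongrightarrow> char_poly_fun R K T \<gamma> * (\<Prod>r<R. lin_form K (l' r) \<delta>)"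
      by (simp only:) (intro tendsto_mult tendsto_char_poly_fun lim prod_lim)
  qed
  moreover have "(\<Prod>r<R. lin_form K (l' r) \<gamma>) \<noteq> 0" using \<gamma>(2) by simp
  ultimately show ?thesis using l(2) by (simp add: char_poly_splits_def field_simps)
qed

lemma (in normed_conjugation) jge_pairs_convergent_subseq:
  fixes l x :: "nat \<Rightarrow> nat \<Rightarrow> 'a vec"
  assumes l: "\<And>n r. r < R \<Longrightarrow> l n r \<in> carrier_vec K" "\<And>n r. r < R \<Longrightarrow> vec_norm1 (l n r) = 1"
    and x: "\<And>n r. r < R \<Longrightarrow> x n r \<in> carrier_vec R" "\<And>n r. r < R \<Longrightarrow> vec_norm1 (x n r) = 1"
  obtains s l' x' where "strict_mono (s :: nat \<Rightarrow> nat)"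
    "\<And>r. r < R \<Longrightarrow> l' r \<in> carrier_vec K \<and> l' r \<noteq> 0\<^sub>v K"
    "\<And>r k. r < R \<Longrightarrow> k < K \<Longrightarrow> (\<lambda>n. l (s n) r $ k) \<longlonglongrightarrow> l' r $ k"
    "\<And>r. r < R \<Longrightarrow> x' r \<in> carrier_vec R \<and> x' r \<noteq> 0\<^sub>v R"
    "\<And>r j. r < R \<Longrightarrow> j < R \<Longrightarrow> (\<lambda>n. x (s n) r $ j) \<longlonglongrightarrow> x' r $ j"
proof -
  obtain s w where "strict_mono (s :: nat \<Rightarrow> nat)"
    and w: "\<And>i. i \<in> {..<R} <+> {..<R} \<Longrightarrow> w i \<in> carrier_vec (case_sum (\<lambda>_. K) (\<lambda>_. R) i) \<and>
        w i \<noteq> 0\<^sub>v (case_sum (\<lambda>_. K) (\<lambda>_. R) i)"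
    and lim: "\<And>i k. i \<in> {..<R} <+> {..<R} \<Longrightarrow> k < case_sum (\<lambda>_. K) (\<lambda>_. R) i \<Longrightarrow>
        (\<lambda>n. case_sum (l (s n)) (x (s n)) i $ k) \<longlonglongrightarrow> w i $ k"
    by (rule normalized_vecs_convergent_subseq[of "{..<R} <+> {..<R}" "\<lambda>n. case_sum (l n) (x n)"
          "case_sum (\<lambda>_. K) (\<lambda>_. R)"]) (use l x in auto)
  then show thesis
    using w[OF InlI] w[OF InrI] lim[OF InlI] lim[OF InrI]
    by (intro that[of s "\<lambda>r. w (Inl r)" "\<lambda>r. w (Inr r)"]) auto
qed

lemma (in normed_conjugation) limit_of_cpds_splits:
  fixes T :: "'a tensor3"
  assumes cpd: "\<And>n. has_cpd R R K (S n) R"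
    and lim: "\<And>i j k. i < R \<Longrightarrow> j < R \<Longrightarrow> k < K \<Longrightarrow> (\<lambda>n. S n i j k) \<longlonglongrightarrow> T i j k"
    and \<gamma>: "\<gamma> \<in> carrier_vec K" "char_poly_fun R K T \<gamma> \<noteq> 0"
  obtains d l x where "char_poly_splits R K T d l"
    "\<And>r. r < R \<Longrightarrow> jge_pair R K T (vspan K {l r}) (x r)"
proof -
  have "\<forall>\<^sub>F n in sequentially. char_poly_fun R K (S n) \<gamma> \<noteq> 0"
    using tendsto_imp_eventually_ne[OF tendsto_char_poly_fun \<gamma>(2)] lim by blast
  then obtain n0 where "\<And>n. n \<ge> n0 \<Longrightarrow> char_poly_fun R K (S n) \<gamma> \<noteq> 0"
    unfolding eventually_sequentially by blast
  then have char: "char_poly_fun R K (S (n + n0)) \<gamma> \<noteq> 0" for n by simp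
  have "\<forall>n. \<exists>d l x. char_poly_splits R K (S (n + n0)) d l \<and> (\<forall>r<R. vec_norm1 (l r) = 1 \<and>
      vec_norm1 (x r) = 1 \<and> jge_pair R K (S (n + n0)) (vspan K {l r}) (x r))"
    using cpd_normalized_jge_pairs[OF cpd \<gamma>(1) char] by metis
  then obtain d l x where splits: "\<And>n. char_poly_splits R K (S (n + n0)) (d n) (l n)"
    and norm: "\<And>n r. r < R \<Longrightarrow> vec_norm1 (l n r) = 1" "\<And>n r. r < R \<Longrightarrow> vec_norm1 (x n r) = 1"
    and pair: "\<And>n r. r < R \<Longrightarrow> jge_pair R K (S (n + n0)) (vspan K {l n r}) (x n r)"
    by metis
  have l: "l n r \<in> carrier_vec K" and x: "x n r \<in> carrier_vec R" if "r < R" for n r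
    using splits[of n] pair[OF that, of n] that by (auto simp: char_poly_splits_def jge_pair_def)
  obtain s l' x' where s: "strict_mono (s :: nat \<Rightarrow> nat)"
    and l': "\<And>r. r < R \<Longrightarrow> l' r \<in> carrier_vec K \<and> l' r \<noteq> 0\<^sub>v K"
      "\<And>r k. r < R \<Longrightarrow> k < K \<Longrightarrow> (\<lambda>n. l (s n) r $ k) \<longlonglongrightarrow> l' r $ k"
    and x': "\<And>r. r < R \<Longrightarrow> x' r \<in> carrier_vec R \<and> x' r \<noteq> 0\<^sub>v R"
      "\<And>r j. r < R \<Longrightarrow> j < R \<Longrightarrow> (\<lambda>n. x (s n) r $ j) \<longlonglongrightarrow> x' r $ j"
    using jge_pairs_convergent_subseq[of R l K x] l x norm by blast
  have s_lim: "(\<lambda>n. S (s n + n0) i j k) \<longlonglongrightarrow> T i j k" if "i < R" "j < R" "k < K" for i j k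
    using LIMSEQ_subseq_LIMSEQ[OF LIMSEQ_ignore_initial_segment[OF lim[OF that]] s]
    by (simp add: o_def)
  have pair': "jge_pair R K T (vspan K {l' r}) (x' r)" if r: "r < R" for r
    by (rule jge_pair_limit[where S = "\<lambda>n. S (s n + n0)", OF s_lim char \<gamma>(2) pair l l'(2)])
      (use r l' x' in auto)
  then have "lin_form K (l' r) \<gamma> \<noteq> 0" if "r < R" for r
    using jge_pair_imp_lin_form_nonzero[OF \<gamma>(2)] l'(1) that by blast
  then have "char_poly_splits R K T (char_poly_fun R K T \<gamma> / (\<Prod>r<R. lin_form K (l' r) \<gamma>)) l'"
    using char_poly_splits_limit[OF s_lim splits l'(2) _ \<gamma>(1)] l'(1) by blast
  then show thesis using that pair' by blast
qed

section \<open>Independence of joint generalized eigenvectors\<close>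

lemma kernel_eigenvalue_poly_invariant:
  fixes M N Z :: "'a::field mat" and \<nu> :: "nat \<Rightarrow> 'a"
  assumes M: "M \<in> carrier_mat n n" and N: "N \<in> carrier_mat n n" "det N \<noteq> 0"
    and Z: "Z \<in> carrier_mat n m" and eig: "M * Z = N * (Z * mat_diag m \<nu>)"
    and a: "a \<in> carrier_vec m" "Z *\<^sub>v a = 0\<^sub>v n"
  shows "Z *\<^sub>v vec m (\<lambda>r. poly p (\<nu> r) * a $ r) = 0\<^sub>v n"
proof (induction p)
  case 0
  have "vec m (\<lambda>r. 0) = (0\<^sub>v m :: 'a vec)" by auto
  then show ?case using Z by auto
next
  case (pCons c p)
  let ?b = "vec m (\<lambda>r. poly p (\<nu> r) * a $ r)"
  have "N *\<^sub>v (Z *\<^sub>v (mat_diag m \<nu> *\<^sub>v ?b)) = (N * (Z * mat_diag m \<nu>)) *\<^sub>v ?b"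
    by (simp only: assoc_mult_mat_vec[OF N(1) mult_carrier_mat[OF Z mat_diag_dim] vec_carrier]
        assoc_mult_mat_vec[OF Z mat_diag_dim vec_carrier])
  also have "\<dots> = 0\<^sub>v n"
    using M Z pCons.IH unfolding eig[symmetric]
    by (simp add: assoc_mult_mat_vec[of _ n n _ m] mult_mat_zero_vec)
  finally have "Z *\<^sub>v (mat_diag m \<nu> *\<^sub>v ?b) = 0\<^sub>v n"
    using det_nonzero_mult_vec_eq_0_iff[OF N] Z by (simp add: mat_diag_mult_vec)
  moreover have "vec m (\<lambda>r. poly (pCons c p) (\<nu> r) * a $ r) = c \<cdot>\<^sub>v a + mat_diag m \<nu> *\<^sub>v ?b"
    using a(1) by (auto simp: mat_diag_mult_vec algebra_simps)
  ultimately have "Z *\<^sub>v vec m (\<lambda>r. poly (pCons c p) (\<nu> r) * a $ r) = c \<cdot>\<^sub>v 0\<^sub>v n + 0\<^sub>v n"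
    using Z a
    by (simp add: mult_add_distrib_mat_vec[of _ n m] mult_mat_vec[of _ n m] mat_diag_mult_vec)
  then show ?case by auto
qed

lemma kernel_eigenvalue_component:
  fixes M N Z :: "'a::field mat" and \<nu> :: "nat \<Rightarrow> 'a"
  assumes "M \<in> carrier_mat n n" "N \<in> carrier_mat n n" "det N \<noteq> 0" and Z: "Z \<in> carrier_mat n m"
    and "M * Z = N * (Z * mat_diag m \<nu>)" "a \<in> carrier_vec m" "Z *\<^sub>v a = 0\<^sub>v n"
  shows "Z *\<^sub>v vec m (\<lambda>r. if \<nu> r = c then a $ r else 0) = 0\<^sub>v n"
proof -
  let ?B = "\<nu> ` {..<m} - {c}"
  define p where "p = (\<Prod>b\<in>?B. [:- b, 1:])"
  have p: "poly p x = (\<Prod>b\<in>?B. x - b)" for x by (simp add: p_def poly_prod)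
  have c: "poly p c \<noteq> 0" by (auto simp: p)
  have "vec m (\<lambda>r. poly p (\<nu> r) * a $ r) = poly p c \<cdot>\<^sub>v vec m (\<lambda>r. if \<nu> r = c then a $ r else 0)"
    by (auto simp: p)
  then have "poly p c \<cdot>\<^sub>v (Z *\<^sub>v vec m (\<lambda>r. if \<nu> r = c then a $ r else 0)) = 0\<^sub>v n"
    using kernel_eigenvalue_poly_invariant[OF assms, of p] mult_mat_vec[OF Z] by simp
  then show ?thesis using c Z by (auto simp: vec_eq_iff simp del: index_mult_mat_vec)
qed

lemma kernel_joint_eigenvalue_component:
  fixes N Z :: "'a::field mat" and \<mu> :: "nat \<Rightarrow> nat \<Rightarrow> 'a"
  assumes M: "\<And>k. k < K \<Longrightarrow> M k \<in> carrier_mat n n" and N: "N \<in> carrier_mat n n" "det N \<noteq> 0"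
    and Z: "Z \<in> carrier_mat n m"
    and eig: "\<And>k. k < K \<Longrightarrow> M k * Z = N * (Z * mat_diag m (\<lambda>r. \<mu> r k))"
    and a: "a \<in> carrier_vec m" "Z *\<^sub>v a = 0\<^sub>v n"
  shows "Z *\<^sub>v vec m (\<lambda>r. if \<forall>k<K. \<mu> r k = c k then a $ r else 0) = 0\<^sub>v n"
  using M eig
proof (induction K)
  case 0
  have "vec m (\<lambda>r. a $ r) = a" using a(1) by auto
  then show ?case using a(2) by simp
next
  case (Suc K)
  let ?b = "vec m (\<lambda>r. if \<forall>k<K. \<mu> r k = c k then a $ r else 0)"
  have "Z *\<^sub>v vec m (\<lambda>r. if \<mu> r K = c K then ?b $ r else 0) = 0\<^sub>v n"
    by (rule kernel_eigenvalue_component[OF Suc.prems(1) N Z Suc.prems(2)]) (use Suc in auto)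
  moreover have "vec m (\<lambda>r. if \<mu> r K = c K then ?b $ r else 0)
      = vec m (\<lambda>r. if \<forall>k<Suc K. \<mu> r k = c k then a $ r else 0)"
    by (intro eq_vecI) (auto simp: less_Suc_eq)
  ultimately show ?case by simp
qed

lemma vspan_eq_iff_ratios_eq:
  fixes lam mu :: "'a::field vec"
  assumes lam: "lam \<in> carrier_vec K" "lin_form K lam \<gamma> \<noteq> 0"
    and mu: "mu \<in> carrier_vec K" "lin_form K mu \<gamma> \<noteq> 0"
  shows "vspan K {lam} = vspan K {mu} \<longleftrightarrow>
    (\<forall>k<K. lam $ k / lin_form K lam \<gamma> = mu $ k / lin_form K mu \<gamma>)"
proof -
  have "lam \<noteq> 0\<^sub>v K" using lam(2) by (auto simp: lin_form_def)
  note span_eq = vspan_singleton_eq_iff[OF mu(1) lam(1) this]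
  show ?thesis
  proof
    assume "vspan K {lam} = vspan K {mu}"
    then obtain c where "c \<noteq> 0" "lam = c \<cdot>\<^sub>v mu" using span_eq by blast
    then show "\<forall>k<K. lam $ k / lin_form K lam \<gamma> = mu $ k / lin_form K mu \<gamma>"
      using mu by (simp add: lin_form_smult)
  next
    assume ratios: "\<forall>k<K. lam $ k / lin_form K lam \<gamma> = mu $ k / lin_form K mu \<gamma>"
    have "lam = (lin_form K lam \<gamma> / lin_form K mu \<gamma>) \<cdot>\<^sub>v mu"
      using ratios lam mu by (intro eq_vecI) (auto simp: field_simps)
    then show "vspan K {lam} = vspan K {mu}"
      unfolding span_eq using lam(2) mu(2) by (metis divide_eq_0_iff)
  qed
qed

lemma slice_mult_jge_vector_matrix:
  fixes T :: "'a::field tensor3" and m :: nat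
  assumes char: "char_poly_fun R K T \<gamma> \<noteq> 0"
    and l: "\<And>r. r < m \<Longrightarrow> l r \<in> carrier_vec K"
    and pair: "\<And>r. r < m \<Longrightarrow> jge_pair R K T (vspan K {l r}) (z r)" and k: "k < K"
    and Z: "Z = mat_of_cols R (map z [0..<m])"
  shows "slice R T k * Z
    = slice_comb R K T \<gamma> * (Z * mat_diag m (\<lambda>r. l r $ k / lin_form K (l r) \<gamma>))"
    (is "_ = ?N * (Z * mat_diag m ?\<mu>)")
proof (rule mat_col_eqI)
  have Z_carrier: "Z \<in> carrier_mat R m" unfolding Z by (rule mat_of_cols_map_carrier)
  then show "dim_row (slice R T k * Z) = dim_row (?N * (Z * mat_diag m ?\<mu>))"
    "dim_col (slice R T k * Z) = dim_col (?N * (Z * mat_diag m ?\<mu>))"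
    by (simp_all add: slice_def slice_comb_def mat_diag_def)
  fix r assume "r < dim_col (?N * (Z * mat_diag m ?\<mu>))"
  then have r: "r < m" by (simp add: mat_diag_def)
  have z: "z r \<in> carrier_vec R" using pair[OF r] by (simp add: jge_pair_def)
  then have "col Z r = z r" using r by (simp add: Z)
  then have "col (slice R T k * Z) r = ?\<mu> r \<cdot>\<^sub>v (?N *\<^sub>v z r)"
    using col_mult2[OF slice_carrier Z_carrier r]
      slice_mult_jge_vector[OF char l[OF r] pair[OF r] k]
    by simp
  also have "\<dots> = ?N *\<^sub>v (?\<mu> r \<cdot>\<^sub>v z r)" using mult_mat_vec[OF slice_comb_carrier z] by simp
  also have "?\<mu> r \<cdot>\<^sub>v z r = col (Z * mat_diag m ?\<mu>) r"
    unfolding mat_diag_mult_right[OF Z_carrier]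
    using r z by (intro eq_vecI) (auto simp: Z mat_of_cols_index)
  also have "?N *\<^sub>v col (Z * mat_diag m ?\<mu>) r = col (?N * (Z * mat_diag m ?\<mu>)) r"
    using col_mult2[OF slice_comb_carrier mult_carrier_mat[OF Z_carrier mat_diag_dim] r] by simp
  finally show "col (slice R T k * Z) r = col (?N * (Z * mat_diag m ?\<mu>)) r" .
qed

lemma independent_family_if_jge_classes_independent:
  fixes T :: "'a::field tensor3" and m :: nat
  assumes char: "char_poly_fun R K T \<gamma> \<noteq> 0"
    and l: "\<And>r. r < m \<Longrightarrow> l r \<in> carrier_vec K"
    and pair: "\<And>r. r < m \<Longrightarrow> jge_pair R K T (vspan K {l r}) (z r)"
    and class_indep: "\<And>r. r < m \<Longrightarrow>
      independent_family R {s. s < m \<and> vspan K {l s} = vspan K {l r}} z"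
  shows "independent_family R {..<m} z"
  unfolding independent_family_def
proof (intro allI impI ballI)
  fix a r assume zero: "\<forall>i<R. (\<Sum>s<m. a s * z s $ i) = 0" and "r \<in> {..<m}"
  then have r: "r < m" by simp
  define \<mu> where "\<mu> s k = l s $ k / lin_form K (l s) \<gamma>" for s k
  define Z where "Z = mat_of_cols R (map z [0..<m])"
  have Z: "Z \<in> carrier_mat R m" unfolding Z_def by (rule mat_of_cols_map_carrier)
  have Z_mult: "(Z *\<^sub>v v) $ i = (\<Sum>s<m. v $ s * z s $ i)" if "v \<in> carrier_vec m" "i < R" for v i
    unfolding Z_def using that by (rule mat_of_cols_mult_vec_index)
  have kernel: "Z *\<^sub>v vec m a = 0\<^sub>v R"
    using zero Z by (intro eq_vecI) (auto simp: Z_mult simp del: index_mult_mat_vec)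
  have eigen_Z: "slice R T k * Z = slice_comb R K T \<gamma> * (Z * mat_diag m (\<lambda>s. \<mu> s k))"
    if "k < K" for k
    unfolding \<mu>_def by (rule slice_mult_jge_vector_matrix[OF char l pair that Z_def])
  let ?v = "vec m (\<lambda>s. if \<forall>k<K. \<mu> s k = \<mu> r k then vec m a $ s else 0)"
  have component: "Z *\<^sub>v ?v = 0\<^sub>v R"
    by (rule kernel_joint_eigenvalue_component[OF slice_carrier slice_comb_carrier
          char[unfolded char_poly_fun_def] Z eigen_Z vec_carrier kernel])
  let ?C = "{s. s < m \<and> vspan K {l s} = vspan K {l r}}"
  have same_class: "(\<forall>k<K. \<mu> s k = \<mu> r k) \<longleftrightarrow> vspan K {l s} = vspan K {l r}" if s: "s < m" for s
    unfolding \<mu>_def using l[OF s] l[OF r] char pair[OF s] pair[OF r]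
    by (intro vspan_eq_iff_ratios_eq[symmetric] jge_pair_imp_lin_form_nonzero)
  have "(\<Sum>s\<in>?C. a s * z s $ i) = 0" if i: "i < R" for i
  proof -
    have "(\<Sum>s\<in>?C. a s * z s $ i) = (\<Sum>s<m. ?v $ s * z s $ i)"
      by (intro sum.mono_neutral_cong_left) (auto simp: same_class)
    also have "\<dots> = 0"
      unfolding Z_mult[OF vec_carrier i, symmetric] component using i by simp
    finally show ?thesis .
  qed
  then have "\<forall>s\<in>?C. a s = 0" using class_indep[OF r] unfolding independent_family_def by blast
  then show "a r = 0" using r by simp
qed

lemma jge_vectors_span_if_gm_ge:
  fixes T :: "'a::field tensor3"
  assumes char: "char_poly_fun R K T \<gamma> \<noteq> 0"
    and l: "\<And>r. r < R \<Longrightarrow> l r \<in> carrier_vec K"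
    and gm: "\<And>r. r < R \<Longrightarrow>
      card {s. s < R \<and> vspan K {l s} = vspan K {l r}} \<le> jge_gm R K T (vspan K {l r})"
  shows "vspan R {x. jge_vector R K T x} = carrier_vec R"
proof -
  let ?C = "\<lambda>L. {s. s < R \<and> vspan K {l s} = L}"
  have "\<forall>L\<in>(\<lambda>r. vspan K {l r}) ` {..<R}.
    \<exists>z. (\<forall>s\<in>?C L. jge_pair R K T L (z s)) \<and> independent_family R (?C L) z"
  proof
    fix L assume "L \<in> (\<lambda>r. vspan K {l r}) ` {..<R}"
    then have "card (?C L) \<le> vdim R {x. jge_pair R K T L x}" using gm by (auto simp: jge_gm_def)
    then obtain z where "\<And>s. s \<in> ?C L \<Longrightarrow> z s \<in> {x. jge_pair R K T L x}"
        "independent_family R (?C L) z"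
      using vdim_obtain_independent_family[OF jge_pairs_subset_carrier, of "?C L" R K T L] by auto
    then show "\<exists>z. (\<forall>s\<in>?C L. jge_pair R K T L (z s)) \<and> independent_family R (?C L) z" by blast
  qed
  from bchoice[OF this] obtain zs where zs: "\<forall>L\<in>(\<lambda>r. vspan K {l r}) ` {..<R}.
      (\<forall>s\<in>?C L. jge_pair R K T L (zs L s)) \<and> independent_family R (?C L) (zs L)" ..
  define z where "z r = zs (vspan K {l r}) r" for r
  have pair: "jge_pair R K T (vspan K {l r}) (z r)" if "r < R" for r
    using zs that by (simp add: z_def)
  have class_indep: "independent_family R (?C (vspan K {l r})) z" if "r < R" for r
  proof -
    have "independent_family R (?C (vspan K {l r})) (zs (vspan K {l r}))" using zs that by simp
    then show ?thesis by (rule iffD1[OF independent_family_cong, rotated]) (simp add: z_def)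
  qed
  have "independent_family R {..<R} z"
    by (rule independent_family_if_jge_classes_independent[OF char, where l = l])
      (fact l pair class_indep)+
  then have "det (mat_of_cols R (map z [0..<R])) \<noteq> 0" by (rule independent_family_imp_det)
  moreover have "jge_vector R K T (col (mat_of_cols R (map z [0..<R])) r)" if "r < R" for r
    using pair[OF that] that by (auto simp: jge_vector_def jge_pair_def)
  ultimately show ?thesis
    unfolding vspan_eq_carrier_iff[OF jge_vectors_subset_carrier]
    using mat_of_cols_map_carrier by blast
qed

section \<open>Border rank\<close>

lemma obtain_border_rank_sequence:
  fixes T :: "'a::{comm_ring_1, real_normed_vector} tensor3"
  assumes T: "tensor3_in I1 I2 I3 T"
  obtains S where "\<And>n. has_cpd I1 I2 I3 (S n) (border_rank I1 I2 I3 T)"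
    "\<And>i j k. (\<lambda>n. S n i j k) \<longlonglongrightarrow> T i j k"
proof -
  let ?Q = "\<lambda>R. \<exists>S :: nat \<Rightarrow> 'a tensor3.
      (\<forall>n. tensor3_in I1 I2 I3 (S n) \<and> tensor_rank I1 I2 I3 (S n) \<le> R) \<and>
      (\<forall>i j k. (\<lambda>n. S n i j k) \<longlonglongrightarrow> T i j k)"
  have "?Q (tensor_rank I1 I2 I3 T)" using T by (intro exI[of _ "\<lambda>_. T"]) simp
  then have "?Q (border_rank I1 I2 I3 T)" unfolding border_rank_def by (rule LeastI)
  then show thesis using that tensor_rank_le_iff by blast
qed

lemma tendsto_mode_products:
  fixes S :: "'b \<Rightarrow> 'a::real_normed_field tensor3"
  assumes "\<And>i j k. ((\<lambda>n. S n i j k) \<longlongrightarrow> T i j k) F"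
  shows "((\<lambda>n. mode_products U V W (S n) a b c) \<longlongrightarrow> mode_products U V W T a b c) F"
  unfolding mode_products_def using assms by (auto intro!: tendsto_intros)

locale normed_tensor_compression =
  square_tensor_compression I1 I2 I3 R K Tp T V1 V2 V3 + normed_conjugation "TYPE('a)"
  for I1 I2 I3 R K :: nat and Tp T :: "'a::{conjugatable_field, real_normed_field} tensor3"
    and V1 V2 V3 :: "'a mat"
begin

lemma border_rank_obtain_cpd_sequence:
  obtains S where "\<And>n. has_cpd R R K (S n) (border_rank I1 I2 I3 Tp)"
    "\<And>i j k. (\<lambda>n. S n i j k) \<longlonglongrightarrow> T i j k"
proof -
  obtain S where S: "\<And>n. has_cpd I1 I2 I3 (S n) (border_rank I1 I2 I3 Tp)"
    and lim: "\<And>i j k. (\<lambda>n. S n i j k) \<longlonglongrightarrow> Tp i j k"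
    using obtain_border_rank_sequence[OF Tp_in] by blast
  show thesis
  proof (rule that)
    show "has_cpd R R K (mode_products (adj V1) (adj V2) (adj V3) (S n))
      (border_rank I1 I2 I3 Tp)" for n
      by (rule has_cpd_mode_products[OF adj_V_carrier S])
    show "(\<lambda>n. mode_products (adj V1) (adj V2) (adj V3) (S n) i j k) \<longlonglongrightarrow> T i j k" for i j k
      unfolding T_eq_mode_products by (rule tendsto_mode_products[OF lim])
  qed
qed

lemma tensor_rank_eq_iff_has_cpd: "tensor_rank I1 I2 I3 Tp = R \<longleftrightarrow> has_cpd R R K T R"
  using tensor_rank_le_iff[OF Tp_in] has_cpd_compression_iff has_cpd_imp_le
  by (metis order_antisym order_refl)

lemma tensor_rank_eq_iff_jge_vectors_span:
  "tensor_rank I1 I2 I3 Tp = R \<longleftrightarrow> vspan R {x. jge_vector R K T x} = carrier_vec R"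
  by (simp only: tensor_rank_eq_iff_has_cpd has_cpd_iff_jge_vectors_span)

lemma border_rank_obtain_defective_jge_value:
  assumes border: "border_rank I1 I2 I3 Tp = R" and mix: "slice_mix_invertible R K T"
    and rank: "tensor_rank I1 I2 I3 Tp \<noteq> R"
  obtains lam where "lam \<in> carrier_vec K" "lam \<noteq> 0\<^sub>v K" "jge_value R K T (vspan K {lam})"
    "1 \<le> jge_gm R K T (vspan K {lam})"
    "jge_gm R K T (vspan K {lam}) < jge_am R K T (vspan K {lam})"
    "lin_pow_dvd_char R K T lam (jge_am R K T (vspan K {lam}))"
proof -
  obtain \<gamma> where \<gamma>: "\<gamma> \<in> carrier_vec K" "char_poly_fun R K T \<gamma> \<noteq> 0"
    using mix unfolding slice_mix_invertible_iff by blast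
  obtain S where S: "\<And>n. has_cpd R R K (S n) R" "\<And>i j k. (\<lambda>n. S n i j k) \<longlonglongrightarrow> T i j k"
    using border_rank_obtain_cpd_sequence unfolding border by blast
  obtain d l x where splits: "char_poly_splits R K T d l"
    and pair: "\<And>r. r < R \<Longrightarrow> jge_pair R K T (vspan K {l r}) (x r)"
    using limit_of_cpds_splits[OF S \<gamma>] by blast
  have l: "l r \<in> carrier_vec K" if "r < R" for r
    using splits that by (simp add: char_poly_splits_def)
  have l0: "l r \<noteq> 0\<^sub>v K" if "r < R" for r
    using jge_pair_iff_slice_comb[OF \<gamma>(2) l[OF that]] pair[OF that] by blast
  let ?mult = "\<lambda>r. card {s. s < R \<and> vspan K {l s} = vspan K {l r}}"
  have "vspan R {x. jge_vector R K T x} \<noteq> carrier_vec R"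
    using rank tensor_rank_eq_iff_jge_vectors_span by blast
  then obtain r where r: "r < R" and defective: "jge_gm R K T (vspan K {l r}) < ?mult r"
    using jge_vectors_span_if_gm_ge[OF \<gamma>(2) l] by (meson not_le)
  have "lin_pow_dvd_char R K T (l r) (?mult r)"
    by (rule char_poly_splits_imp_lin_pow_dvd_char[OF splits l0 r])
  note am = le_jge_am[OF \<gamma> l[OF r] l0[OF r] this]
    lin_pow_dvd_char_jge_am[OF \<gamma> l[OF r] l0[OF r] this]
  show thesis
  proof
    show "1 \<le> jge_gm R K T (vspan K {l r})"
      using vdim_pos[OF jge_pairs_subset_carrier, of "x r"] pair[OF r]
      by (simp add: jge_gm_def jge_pair_def)
    show "jge_value R K T (vspan K {l r})" using pair[OF r] by (auto simp: jge_value_def)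
    show "jge_gm R K T (vspan K {l r}) < jge_am R K T (vspan K {l r})" using defective am(1) by simp
  qed (use l l0 r am(2) in auto)
qed

lemma border_rank_simple_imp_tensor_rank:
  assumes border: "border_rank I1 I2 I3 Tp = R" and simple: "simple_tensor R K T"
  shows "tensor_rank I1 I2 I3 Tp = R"
proof (rule ccontr)
  assume "tensor_rank I1 I2 I3 Tp \<noteq> R"
  moreover have "slice_mix_invertible R K T" using simple by (simp add: simple_tensor_def)
  ultimately obtain lam where lam: "lam \<in> carrier_vec K" "lam \<noteq> 0\<^sub>v K"
    and mult: "1 \<le> jge_gm R K T (vspan K {lam})"
      "jge_gm R K T (vspan K {lam}) < jge_am R K T (vspan K {lam})"
    and dvd: "lin_pow_dvd_char R K T lam (jge_am R K T (vspan K {lam}))"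
    using border_rank_obtain_defective_jge_value[OF border] by metis
  show False using simple_tensor_no_square_factor[OF simple lam dvd] mult by simp
qed

end

theorem theorem2p3:
  fixes I1 I2 I3 R K :: nat
    and Tp T :: "'a::{conjugatable_field, real_normed_field} tensor3"
  assumes conj_std: "\<And>x::'a. conjugate x * x = of_real ((norm x)\<^sup>2)"
    and Tp_in: "tensor3_in I1 I2 I3 Tp"
    and mlr: "mlrank I1 I2 I3 Tp = (R, R, K)"
    and comp: "orth_compression I1 I2 I3 R R K Tp T"
  shows
    "(tensor_rank I1 I2 I3 Tp = R \<longleftrightarrow> vspan R {x. jge_vector R K T x} = carrier_vec R)
     \<and> (\<forall>A B C. is_decomp R R K T R A B C \<and> tensor_rank R R K T = R \<longrightarrow>
           {L. jge_value R K T L} = {vspan K {col C r} | r. r < R} \<and>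
           invertible_mat B \<and>
           (\<forall>X \<in> carrier_mat R R. transpose_mat B * X = 1\<^sub>m R \<longrightarrow>
              (\<forall>r<R. jge_vector R K T (col X r))))
     \<and> (border_rank I1 I2 I3 Tp = R \<and> simple_tensor R K T \<longrightarrow> tensor_rank I1 I2 I3 Tp = R)
     \<and> (border_rank I1 I2 I3 Tp = R \<and> tensor_rank I1 I2 I3 Tp > R \<and> slice_mix_invertible R K T
          \<longrightarrow> (\<exists>L. jge_value R K T L \<and> jge_gm R K T L \<ge> 1 \<and> jge_am R K T L > jge_gm R K T L))"
proof -
  interpret normed_conjugation "TYPE('a)" by unfold_locales (rule conj_std)
  obtain V1 V2 V3 where "square_tensor_compression I1 I2 I3 R K Tp T V1 V2 V3"
    using orth_compression_imp_square_tensor_compression[OF comp Tp_in] by blast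
  then interpret normed_tensor_compression I1 I2 I3 R K Tp T V1 V2 V3
    by (intro normed_tensor_compression.intro normed_conjugation_axioms)
  have "{L. jge_value R K T L} = {vspan K {col C r} | r. r < R} \<and> invertible_mat B \<and>
      (\<forall>X\<in>carrier_mat R R. transpose_mat B * X = 1\<^sub>m R \<longrightarrow> (\<forall>r<R. jge_vector R K T (col X r)))"
    if "is_decomp R R K T R A B C" for A B C
    using jge_values_and_vectors_of_decomp[OF that] by blast
  moreover have "\<exists>L. jge_value R K T L \<and> jge_gm R K T L \<ge> 1 \<and> jge_am R K T L > jge_gm R K T L"
    if "border_rank I1 I2 I3 Tp = R" "slice_mix_invertible R K T" "tensor_rank I1 I2 I3 Tp > R"
    using border_rank_obtain_defective_jge_value[OF that(1,2)] that(3) by (metis less_irrefl)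
  ultimately show ?thesis
    using tensor_rank_eq_iff_jge_vectors_span border_rank_simple_imp_tensor_rank by blast
qed

end
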